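(* If $(L,T,R)$ is an involutive triad, then $Q_0\xrightarrow{\phi}Q_1$ is an involutive couple. Involutive solutions of $(L,T,R)$ correspond to involutive couple factorizations of $\phi$.
   Context: A sup-lattice is a complete lattice; morphisms of sup-lattices preserve arbitrary joins. A bimorphism $S\times S'\to S''$ preserves arbitrary joins in each variable separately; its values are written as products. A quantale is a sup-lattice with an associative bimorphism $Q\times Q\to Q$. It is involutive if it is equipped with a unary operation $^*$ with $(q^* )^*=q$, $(qq')^*=(q')^*q^*$, $(\bigvee q_i)^*=\bigvee q_i^*$. A quantale morphism is a sup-lattice morphism preserving multiplication; it is involutive if it also preserves $^*$. A left $Q$-module is a sup-lattice $M$ with a bimorphism $Q\times M\to M$ satisfying $(qq')m=q(q'm)$; right modules are analogous; a $(Q,Q')$-bimodule is a left $Q$-module and right $Q'$-module with $(qm)q'=q(mq')$. Module and bimodule morphisms are sup-lattice morphisms commuting with the actions. A (quantum) triad $(L,T,R)$ consists of a quantale $T$, a right $T$-module $R$, a left $T$-module $L$, and a bimorphism $L\times R\to T$, $(l,r)\mapsto lr$, such that $(tl)r=t(lr)$ and $(lr)t=l(rt)$ for all $l\in L$, $r\in R$, $t\in T$. It is involutive if $T$ is an involutive quantale and there is an isomorphism $L\cong R$, written $^*$ (in both directions), such that $(tl)^*=l^*t^*$, $(rt)^*=t^*r^*$, $(lr)^*=r^*l^*$ for all $r\in R$, $l\in L$, $t\in T$. A solution of the triad $(L,T,R)$ is a quantale $Q$ together with a left action $Q\times R\to R$ making $R$ a $(Q,T)$-bimodule, a right action $L\times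 Q\to L$ making $L$ a $(T,Q)$-bimodule, and a bimorphism $R\times L\to Q$, $(r,l)\mapsto rl$, such that for all $q\in Q$, $t\in T$, $r,r'\in R$, $l,l'\in L$: $(qr)l=q(rl)$, $(rl)q=r(lq)$, $(rt)l=r(tl)$, $(lq)r=l(qr)$, $(rl)r'=r(lr')$, $(lr)l'=l(rl')$. A solution $Q$ of an involutive triad is involutive if $Q$ is an involutive quantale and $(qr)^*=r^*q^*$, $(lq)^*=q^*l^*$, $(rl)^*=l^*r^*$ for all $q\in Q$, $r\in R$, $l\in L$. $Q_0=R\otimes_T L$ is the sup-lattice quotient of the sup-lattice tensor product $R\otimes L$ by the congruence generated by $(rt)\otimes l\sim r\otimes(tl)$ for $r\in R$, $l\in L$, $t\in T$, with multiplication $(r\otimes l)(r'\otimes l')=(r(lr'))\otimes l'$. $Q_1$ is the set of pairs $(\alpha,\beta)$ with $\alpha:L\to L$ a left $T$-module morphism, $\beta:R\to R$ a right $T$-module morphism and $\alpha(l)r=l\beta(r)$ for all $l\in L$, $r\in R$, ordered pointwise, with multiplication $(\alpha,\beta)(\alpha',\beta')=(\alpha'\alpha,\beta\beta')$. It acts by $(\alpha,\beta)r=\beta(r)$ and $l(\alpha,\beta)=\alpha(l)$. $Q_0$ is a $(Q_1,Q_1)$-bimodule by $q(r\otimes l)=(qr)\otimes l$, $(r\otimes l)q=r\otimes(lq)$. The map $\phi:Q_0\to Q_1$ is determined by $\phi(r\otimes l)=\big(l'\mapsto (l'r)l,\ r'\mapsto r(lr')\big)$; with this bimodule structure it is a couple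 of quantales in the sense below. A couple of quantales $C\xrightarrow{\phi}Q$ consists of quantales $C,Q$, a $(Q,Q)$-bimodule structure on $C$, and a quantale morphism $\phi:C\to Q$ that is a $(Q,Q)$-bimodule morphism with $cc'=\phi(c)c'=c\phi(c')$ for all $c,c'\in C$ (then $\phi$ is called a coupling map). The couple is involutive if $\phi$ is an involutive morphism of involutive quantales and $(qc)^*=c^*q^*$ for all $q\in Q$, $c\in C$. A couple factorization of a couple $C\xrightarrow{\phi}Q$ is a quantale $K$ with quantale morphisms $\phi_0:C\to K$, $\phi_1:K\to Q$ such that $\phi_1\phi_0=\phi$ and $\phi_0$ is a coupling map for the $(K,K)$-bimodule structure on $C$ obtained by restricting scalars along $\phi_1$; namely $\phi_0(\phi_1(k)c)=k\phi_0(c)$ and $\phi_0(c\,\phi_1(k))=\phi_0(c)k$ for all $c\in C$, $k\in K$. It is involutive if $K$ is an involutive quantale and $\phi_0,\phi_1$ are involutive morphisms. *)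

theory Defs
  imports "HOL-Algebra.Complete_Lattice" "HOL-Library.FuncSet"
begin

text \<open>
  All structures are carrier-based, because the underlying sets of Q0 and Q1 below depend on the
  triad. A sup-lattice is a \<open>complete_lattice\<close> in the sense of HOL-Algebra.
\<close>

section \<open>Sup-lattices, quantales and modules\<close>

definition sup_morphism :: "('a, 'm) gorder_scheme \<Rightarrow> ('b, 'n) gorder_scheme \<Rightarrow> ('a \<Rightarrow> 'b) \<Rightarrow> bool" where
  "sup_morphism X Y f \<longleftrightarrow>
     f \<in> carrier X \<rightarrow> carrier Y \<and>
     (\<forall>A. A \<subseteq> carrier X \<longrightarrow> f (\<Squnion>\<^bsub>X\<^esub>A) = \<Squnion>\<^bsub>Y\<^esub>(f ` A))"

definition bimorphism ::
  "('a, 'm) gorder_scheme \<Rightarrow> ('b, 'n) gorder_scheme \<Rightarrow> ('c, 'k) gorder_scheme \<Rightarrow> ('a \<Rightarrow> 'b \<Rightarrow> 'c) \<Rightarrow> bool"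
where
  "bimorphism X Y Z b \<longleftrightarrow>
     (\<forall>x\<in>carrier X. sup_morphism Y Z (\<lambda>y. b x y)) \<and>
     (\<forall>y\<in>carrier Y. sup_morphism X Z (\<lambda>x. b x y))"

record 'a quantale = "'a gorder" +
  qmult :: "'a \<Rightarrow> 'a \<Rightarrow> 'a"  (infixl \<open>\<cdot>\<index>\<close> 70)

locale quantale = complete_lattice Q for Q (structure) +
  assumes qmult_bimorphism: "bimorphism Q Q Q (qmult Q)"
    and qmult_assoc:
      "\<lbrakk>a \<in> carrier Q; b \<in> carrier Q; c \<in> carrier Q\<rbrakk> \<Longrightarrow> (a \<cdot> b) \<cdot> c = a \<cdot> (b \<cdot> c)"

locale involutive_quantale = quantale Q for Q (structure) and star :: "'a \<Rightarrow> 'a" +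
  assumes star_sup: "sup_morphism Q Q star"
    and star_star: "q \<in> carrier Q \<Longrightarrow> star (star q) = q"
    and star_mult:
      "\<lbrakk>q \<in> carrier Q; q' \<in> carrier Q\<rbrakk> \<Longrightarrow> star (q \<cdot> q') = star q' \<cdot> star q"

definition quantale_morphism ::
  "('a, 'm) quantale_scheme \<Rightarrow> ('b, 'n) quantale_scheme \<Rightarrow> ('a \<Rightarrow> 'b) \<Rightarrow> bool" where
  "quantale_morphism Q Q' f \<longleftrightarrow>
     sup_morphism Q Q' f \<and>
     (\<forall>a\<in>carrier Q. \<forall>b\<in>carrier Q. f (a \<cdot>\<^bsub>Q\<^esub> b) = f a \<cdot>\<^bsub>Q'\<^esub> f b)"

definition involutive_morphism ::
  "('a, 'm) quantale_scheme \<Rightarrow> ('a \<Rightarrow> 'a) \<Rightarrow> ('b, 'n) quantale_scheme \<Rightarrow> ('b \<Rightarrow> 'b) \<Rightarrow> ('a \<Rightarrow> 'b) \<Rightarrow> bool"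
where
  "involutive_morphism Q s Q' s' f \<longleftrightarrow>
     quantale_morphism Q Q' f \<and> (\<forall>q\<in>carrier Q. f (s q) = s' (f q))"

definition left_module ::
  "('q, 'm) quantale_scheme \<Rightarrow> ('a, 'n) gorder_scheme \<Rightarrow> ('q \<Rightarrow> 'a \<Rightarrow> 'a) \<Rightarrow> bool" where
  "left_module Q M act \<longleftrightarrow>
     quantale Q \<and> complete_lattice M \<and> bimorphism Q M M act \<and>
     (\<forall>q\<in>carrier Q. \<forall>q'\<in>carrier Q. \<forall>m\<in>carrier M. act (q \<cdot>\<^bsub>Q\<^esub> q') m = act q (act q' m))"

definition right_module ::
  "('q, 'm) quantale_scheme \<Rightarrow> ('a, 'n) gorder_scheme \<Rightarrow> ('a \<Rightarrow> 'q \<Rightarrow> 'a) \<Rightarrow> bool" where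
  "right_module Q M act \<longleftrightarrow>
     quantale Q \<and> complete_lattice M \<and> bimorphism M Q M act \<and>
     (\<forall>q\<in>carrier Q. \<forall>q'\<in>carrier Q. \<forall>m\<in>carrier M. act m (q \<cdot>\<^bsub>Q\<^esub> q') = act (act m q) q')"

definition bimodule ::
  "('q, 'm) quantale_scheme \<Rightarrow> ('p, 'k) quantale_scheme \<Rightarrow> ('a, 'n) gorder_scheme \<Rightarrow>
   ('q \<Rightarrow> 'a \<Rightarrow> 'a) \<Rightarrow> ('a \<Rightarrow> 'p \<Rightarrow> 'a) \<Rightarrow> bool" where
  "bimodule Q Q' M la ra \<longleftrightarrow>
     left_module Q M la \<and> right_module Q' M ra \<and>
     (\<forall>q\<in>carrier Q. \<forall>q'\<in>carrier Q'. \<forall>m\<in>carrier M. ra (la q m) q' = la q (ra m q'))"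

definition left_module_morphism ::
  "('q, 'm) quantale_scheme \<Rightarrow> ('a, 'n) gorder_scheme \<Rightarrow> ('q \<Rightarrow> 'a \<Rightarrow> 'a) \<Rightarrow>
   ('b, 'k) gorder_scheme \<Rightarrow> ('q \<Rightarrow> 'b \<Rightarrow> 'b) \<Rightarrow> ('a \<Rightarrow> 'b) \<Rightarrow> bool" where
  "left_module_morphism Q M act N act' f \<longleftrightarrow>
     sup_morphism M N f \<and> (\<forall>q\<in>carrier Q. \<forall>m\<in>carrier M. f (act q m) = act' q (f m))"

definition right_module_morphism ::
  "('q, 'm) quantale_scheme \<Rightarrow> ('a, 'n) gorder_scheme \<Rightarrow> ('a \<Rightarrow> 'q \<Rightarrow> 'a) \<Rightarrow>
   ('b, 'k) gorder_scheme \<Rightarrow> ('b \<Rightarrow> 'q \<Rightarrow> 'b) \<Rightarrow> ('a \<Rightarrow> 'b) \<Rightarrow> bool" where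
  "right_module_morphism Q M act N act' f \<longleftrightarrow>
     sup_morphism M N f \<and> (\<forall>q\<in>carrier Q. \<forall>m\<in>carrier M. f (act m q) = act' (f m) q)"


section \<open>Couples of quantales\<close>

locale couple =
  fixes C :: "('c, 'm) quantale_scheme"
    and Q :: "('q, 'n) quantale_scheme"
    and la :: "'q \<Rightarrow> 'c \<Rightarrow> 'c"
    and ra :: "'c \<Rightarrow> 'q \<Rightarrow> 'c"
    and \<phi> :: "'c \<Rightarrow> 'q"
  assumes quantale_C: "quantale C"
    and quantale_Q: "quantale Q"
    and bimodule_C: "bimodule Q Q C la ra"
    and coupling_quantale_morphism: "quantale_morphism C Q \<phi>"
    and coupling_left: "left_module_morphism Q C la Q (qmult Q) \<phi>"
    and coupling_right: "right_module_morphism Q C ra Q (qmult Q) \<phi>"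
    and coupling_mult:
      "\<lbrakk>c \<in> carrier C; c' \<in> carrier C\<rbrakk> \<Longrightarrow> c \<cdot>\<^bsub>C\<^esub> c' = la (\<phi> c) c'"
      "\<lbrakk>c \<in> carrier C; c' \<in> carrier C\<rbrakk> \<Longrightarrow> c \<cdot>\<^bsub>C\<^esub> c' = ra c (\<phi> c')"

locale involutive_couple = couple C Q la ra \<phi>
  for C :: "('c, 'm) quantale_scheme" and Q :: "('q, 'n) quantale_scheme" and la ra \<phi> +
  fixes starC :: "'c \<Rightarrow> 'c" and starQ :: "'q \<Rightarrow> 'q"
  assumes involutive_C: "involutive_quantale C starC"
    and involutive_Q: "involutive_quantale Q starQ"
    and coupling_involutive: "involutive_morphism C starC Q starQ \<phi>"
    and star_act:
      "\<lbrakk>q \<in> carrier Q; c \<in> carrier C\<rbrakk> \<Longrightarrow> starC (la q c) = ra (starC c) (starQ q)"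

locale couple_factorization = couple C Q la ra \<phi>
  for C :: "('c, 'm) quantale_scheme" and Q :: "('q, 'n) quantale_scheme" and la ra \<phi> +
  fixes K :: "('k, 'p) quantale_scheme" and \<phi>0 :: "'c \<Rightarrow> 'k" and \<phi>1 :: "'k \<Rightarrow> 'q"
  assumes quantale_K: "quantale K"
    and morphism0: "quantale_morphism C K \<phi>0"
    and morphism1: "quantale_morphism K Q \<phi>1"
    and factorizes: "c \<in> carrier C \<Longrightarrow> \<phi>1 (\<phi>0 c) = \<phi> c"
    \<comment> \<open>restriction of scalars along \<open>\<phi>1\<close>\<close>
    and coupling0: "couple C K (\<lambda>k c. la (\<phi>1 k) c) (\<lambda>c k. ra c (\<phi>1 k)) \<phi>0"

locale involutive_couple_factorization =
  couple_factorization C Q la ra \<phi> K \<phi>0 \<phi>1 +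
  involutive_couple C Q la ra \<phi> starC starQ
  for C :: "('c, 'm) quantale_scheme" and Q :: "('q, 'n) quantale_scheme" and la ra \<phi>
    and starC starQ and K :: "('k, 'p) quantale_scheme" and \<phi>0 \<phi>1 +
  fixes starK :: "'k \<Rightarrow> 'k"
  assumes involutive_K: "involutive_quantale K starK"
    and involutive0: "involutive_morphism C starC K starK \<phi>0"
    and involutive1: "involutive_morphism K starK Q starQ \<phi>1"


section \<open>Triads and their solutions\<close>

record ('l, 't, 'r) triad =
  trL :: "'l gorder"
  trT :: "'t quantale"
  trR :: "'r gorder"
  actL :: "'t \<Rightarrow> 'l \<Rightarrow> 'l"      \<comment> \<open>\<open>tl\<close>\<close>
  actR :: "'r \<Rightarrow> 't \<Rightarrow> 'r"      \<comment> \<open>\<open>rt\<close>\<close>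
  pairing :: "'l \<Rightarrow> 'r \<Rightarrow> 't"   \<comment> \<open>\<open>lr\<close>\<close>

locale triad =
  fixes D :: "('l, 't, 'r, 'z) triad_scheme"
  assumes quantale_T: "quantale (trT D)"
    and module_R: "right_module (trT D) (trR D) (actR D)"
    and module_L: "left_module (trT D) (trL D) (actL D)"
    and pairing_bimorphism: "bimorphism (trL D) (trR D) (trT D) (pairing D)"
    and pairing_left:
      "\<lbrakk>t \<in> carrier (trT D); l \<in> carrier (trL D); r \<in> carrier (trR D)\<rbrakk>
        \<Longrightarrow> pairing D (actL D t l) r = t \<cdot>\<^bsub>trT D\<^esub> pairing D l r"
    and pairing_right:
      "\<lbrakk>t \<in> carrier (trT D); l \<in> carrier (trL D); r \<in> carrier (trR D)\<rbrakk>
        \<Longrightarrow> pairing D l r \<cdot>\<^bsub>trT D\<^esub> t = pairing D l (actR D r t)"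

text \<open>The isomorphism between L and R is given as a pair of mutually inverse sup-lattice morphisms.\<close>

record ('l, 't, 'r) inv_triad = "('l, 't, 'r) triad" +
  starT :: "'t \<Rightarrow> 't"
  starL :: "'l \<Rightarrow> 'r"
  starR :: "'r \<Rightarrow> 'l"

locale involutive_triad = triad D
  for D :: "('l, 't, 'r, 'z) inv_triad_scheme" +
  assumes involutive_T: "involutive_quantale (trT D) (starT D)"
    and starL_sup: "sup_morphism (trL D) (trR D) (starL D)"
    and starR_sup: "sup_morphism (trR D) (trL D) (starR D)"
    and starR_starL: "l \<in> carrier (trL D) \<Longrightarrow> starR D (starL D l) = l"
    and starL_starR: "r \<in> carrier (trR D) \<Longrightarrow> starL D (starR D r) = r"
    and star_actL:
      "\<lbrakk>t \<in> carrier (trT D); l \<in> carrier (trL D)\<rbrakk>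
        \<Longrightarrow> starL D (actL D t l) = actR D (starL D l) (starT D t)"
    and star_actR:
      "\<lbrakk>t \<in> carrier (trT D); r \<in> carrier (trR D)\<rbrakk>
        \<Longrightarrow> starR D (actR D r t) = actL D (starT D t) (starR D r)"
    and star_pairing:
      "\<lbrakk>l \<in> carrier (trL D); r \<in> carrier (trR D)\<rbrakk>
        \<Longrightarrow> starT D (pairing D l r) = pairing D (starR D r) (starL D l)"

text \<open>The solution structure on \<open>Q\<close>: \<open>qR q r\<close> is \<open>qr\<close>, \<open>Lq l q\<close> is \<open>lq\<close>, and \<open>RL r l\<close> is \<open>rl\<close>.\<close>

locale solution = triad D
  for D :: "('l, 't, 'r, 'z) triad_scheme" +
  fixes Q :: "('q, 'm) quantale_scheme"
    and qR :: "'q \<Rightarrow> 'r \<Rightarrow> 'r"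
    and Lq :: "'l \<Rightarrow> 'q \<Rightarrow> 'l"
    and RL :: "'r \<Rightarrow> 'l \<Rightarrow> 'q"
  assumes quantale_Q: "quantale Q"
    and bimodule_R: "bimodule Q (trT D) (trR D) qR (actR D)"
    and bimodule_L: "bimodule (trT D) Q (trL D) (actL D) Lq"
    and RL_bimorphism: "bimorphism (trR D) (trL D) Q RL"
    and sol_qrl:
      "\<lbrakk>q \<in> carrier Q; r \<in> carrier (trR D); l \<in> carrier (trL D)\<rbrakk>
        \<Longrightarrow> RL (qR q r) l = q \<cdot>\<^bsub>Q\<^esub> RL r l"
    and sol_rlq:
      "\<lbrakk>q \<in> carrier Q; r \<in> carrier (trR D); l \<in> carrier (trL D)\<rbrakk>
        \<Longrightarrow> RL r l \<cdot>\<^bsub>Q\<^esub> q = RL r (Lq l q)"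
    and sol_rtl:
      "\<lbrakk>t \<in> carrier (trT D); r \<in> carrier (trR D); l \<in> carrier (trL D)\<rbrakk>
        \<Longrightarrow> RL (actR D r t) l = RL r (actL D t l)"
    and sol_lqr:
      "\<lbrakk>q \<in> carrier Q; r \<in> carrier (trR D); l \<in> carrier (trL D)\<rbrakk>
        \<Longrightarrow> pairing D (Lq l q) r = pairing D l (qR q r)"
    and sol_rlr:
      "\<lbrakk>r \<in> carrier (trR D); l \<in> carrier (trL D); r' \<in> carrier (trR D)\<rbrakk>
        \<Longrightarrow> qR (RL r l) r' = actR D r (pairing D l r')"
    and sol_lrl:
      "\<lbrakk>l \<in> carrier (trL D); r \<in> carrier (trR D); l' \<in> carrier (trL D)\<rbrakk>
        \<Longrightarrow> actL D (pairing D l r) l' = Lq l (RL r l')"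

locale involutive_solution =
  solution D Q qR Lq RL + involutive_triad D
  for D :: "('l, 't, 'r, 'z) inv_triad_scheme" and Q :: "('q, 'm) quantale_scheme" and qR Lq RL +
  fixes star :: "'q \<Rightarrow> 'q"
  assumes involutive_Q: "involutive_quantale Q star"
    and star_qR:
      "\<lbrakk>q \<in> carrier Q; r \<in> carrier (trR D)\<rbrakk> \<Longrightarrow> starR D (qR q r) = Lq (starR D r) (star q)"
    and star_Lq:
      "\<lbrakk>q \<in> carrier Q; l \<in> carrier (trL D)\<rbrakk> \<Longrightarrow> starL D (Lq l q) = qR (star q) (starL D l)"
    and star_RL:
      "\<lbrakk>r \<in> carrier (trR D); l \<in> carrier (trL D)\<rbrakk>
        \<Longrightarrow> star (RL r l) = RL (starL D l) (starR D r)"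


section \<open>Quotients and tensor products of sup-lattices\<close>

text \<open>
  Families of related pairs are represented by subsets \<open>P\<close> of the relation.
\<close>

definition sup_congruence :: "('a, 'm) gorder_scheme \<Rightarrow> ('a \<times> 'a) set \<Rightarrow> bool" where
  "sup_congruence X E \<longleftrightarrow>
     equiv (carrier X) E \<and> (\<forall>P. P \<subseteq> E \<longrightarrow> (\<Squnion>\<^bsub>X\<^esub>(fst ` P), \<Squnion>\<^bsub>X\<^esub>(snd ` P)) \<in> E)"

definition generated_congruence ::
  "('a, 'm) gorder_scheme \<Rightarrow> ('a \<times> 'a) set \<Rightarrow> ('a \<times> 'a) set" where
  "generated_congruence X G = \<Inter>{E. sup_congruence X E \<and> G \<subseteq> E}"

text \<open>
  For a congruence \<open>E\<close>, a class lies below another one iff the join of representatives is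
  equivalent to the representative of the latter, i.e. iff some representatives are comparable.
\<close>

definition sup_quotient :: "('a, 'm) gorder_scheme \<Rightarrow> ('a \<times> 'a) set \<Rightarrow> 'a set gorder" where
  "sup_quotient X E =
     \<lparr>carrier = carrier X // E, eq = (=), le = (\<lambda>A B. \<exists>a\<in>A. \<exists>b\<in>B. a \<sqsubseteq>\<^bsub>X\<^esub> b)\<rparr>"

text \<open>
  The tensor product is the free sup-lattice on \<open>X \<times> Y\<close>, i.e. its power set, modulo the relations
  making \<open>(x, y) \<mapsto> x \<otimes> y\<close> preserve joins in each variable.
\<close>

definition powerset_lattice :: "'a set \<Rightarrow> 'a set gorder" where
  "powerset_lattice S = \<lparr>carrier = Pow S, eq = (=), le = (\<subseteq>)\<rparr>"

definition tensor_congruence ::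
  "('a, 'm) gorder_scheme \<Rightarrow> ('b, 'n) gorder_scheme \<Rightarrow> (('a \<times> 'b) set \<times> ('a \<times> 'b) set) set" where
  "tensor_congruence X Y =
     generated_congruence (powerset_lattice (carrier X \<times> carrier Y))
       ({({(\<Squnion>\<^bsub>X\<^esub>A, y)}, A \<times> {y}) | A y. A \<subseteq> carrier X \<and> y \<in> carrier Y} \<union>
        {({(x, \<Squnion>\<^bsub>Y\<^esub>B)}, {x} \<times> B) | x B. x \<in> carrier X \<and> B \<subseteq> carrier Y})"

definition tensor ::
  "('a, 'm) gorder_scheme \<Rightarrow> ('b, 'n) gorder_scheme \<Rightarrow> ('a \<times> 'b) set set gorder" where
  "tensor X Y =
     sup_quotient (powerset_lattice (carrier X \<times> carrier Y)) (tensor_congruence X Y)"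

definition pure_tensor ::
  "('a, 'm) gorder_scheme \<Rightarrow> ('b, 'n) gorder_scheme \<Rightarrow> 'a \<Rightarrow> 'b \<Rightarrow> ('a \<times> 'b) set set" where
  "pure_tensor X Y x y = tensor_congruence X Y `` {{(x, y)}}"


section \<open>The couple of a triad\<close>

type_synonym ('l, 'r) q0 = "('r \<times> 'l) set set set"
type_synonym ('l, 'r) q1 = "('l \<Rightarrow> 'l) \<times> ('r \<Rightarrow> 'r)"

definition Q0_congruence ::
  "('l, 't, 'r, 'z) triad_scheme \<Rightarrow> (('r \<times> 'l) set set \<times> ('r \<times> 'l) set set) set" where
  "Q0_congruence D =
     generated_congruence (tensor (trR D) (trL D))
       {(pure_tensor (trR D) (trL D) (actR D r t) l, pure_tensor (trR D) (trL D) r (actL D t l))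
         | r t l. r \<in> carrier (trR D) \<and> t \<in> carrier (trT D) \<and> l \<in> carrier (trL D)}"

definition Q0_lattice :: "('l, 't, 'r, 'z) triad_scheme \<Rightarrow> ('l, 'r) q0 gorder" where
  "Q0_lattice D = sup_quotient (tensor (trR D) (trL D)) (Q0_congruence D)"

definition Q0_pure :: "('l, 't, 'r, 'z) triad_scheme \<Rightarrow> 'r \<Rightarrow> 'l \<Rightarrow> ('l, 'r) q0" where
  "Q0_pure D r l = Q0_congruence D `` {pure_tensor (trR D) (trL D) r l}"

text \<open>
  The sup-lattice morphism out of the tensor product over T determined by its values \<open>g r l\<close>
  on \<open>r \<otimes> l\<close>, made unique as a HOL function by extensionality outside the carrier.
\<close>

definition Q0_lift ::
  "('l, 't, 'r, 'z) triad_scheme \<Rightarrow> ('x, 'm) gorder_scheme \<Rightarrow> ('r \<Rightarrow> 'l \<Rightarrow> 'x) \<Rightarrow> ('l, 'r) q0 \<Rightarrow> 'x"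
where
  "Q0_lift D X g =
     (THE f. f \<in> extensional (carrier (Q0_lattice D)) \<and>
        sup_morphism (Q0_lattice D) X f \<and>
        (\<forall>r\<in>carrier (trR D). \<forall>l\<in>carrier (trL D). f (Q0_pure D r l) = g r l))"

text \<open>The multiplication with \<open>(r \<otimes> l)(r' \<otimes> l') = r(lr') \<otimes> l'\<close>, extended in one variable at a time.\<close>

definition Q0_mult :: "('l, 't, 'r, 'z) triad_scheme \<Rightarrow> ('l, 'r) q0 \<Rightarrow> ('l, 'r) q0 \<Rightarrow> ('l, 'r) q0" where
  "Q0_mult D c c' =
     Q0_lift D (Q0_lattice D)
       (\<lambda>r l. Q0_lift D (Q0_lattice D) (\<lambda>r' l'. Q0_pure D (actR D r (pairing D l r')) l') c') c"

definition Q0 :: "('l, 't, 'r, 'z) triad_scheme \<Rightarrow> ('l, 'r) q0 quantale" where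
  "Q0 D =
     \<lparr>carrier = carrier (Q0_lattice D), eq = (=), le = le (Q0_lattice D), qmult = Q0_mult D\<rparr>"

text \<open>Membership in \<open>\<rightarrow>\<^sub>E\<close> makes equality of elements of Q1 agree with equality of maps on L and R.\<close>

definition Q1 :: "('l, 't, 'r, 'z) triad_scheme \<Rightarrow> ('l, 'r) q1 quantale" where
  "Q1 D =
     \<lparr>carrier = {(\<alpha>, \<beta>).
        \<alpha> \<in> carrier (trL D) \<rightarrow>\<^sub>E carrier (trL D) \<and>
        \<beta> \<in> carrier (trR D) \<rightarrow>\<^sub>E carrier (trR D) \<and>
        left_module_morphism (trT D) (trL D) (actL D) (trL D) (actL D) \<alpha> \<and>
        right_module_morphism (trT D) (trR D) (actR D) (trR D) (actR D) \<beta> \<and>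
        (\<forall>l\<in>carrier (trL D). \<forall>r\<in>carrier (trR D). pairing D (\<alpha> l) r = pairing D l (\<beta> r))},
      eq = (=),
      le = (\<lambda>(\<alpha>, \<beta>) (\<alpha>', \<beta>').
        (\<forall>l\<in>carrier (trL D). \<alpha> l \<sqsubseteq>\<^bsub>trL D\<^esub> \<alpha>' l) \<and>
        (\<forall>r\<in>carrier (trR D). \<beta> r \<sqsubseteq>\<^bsub>trR D\<^esub> \<beta>' r)),
      qmult = (\<lambda>(\<alpha>, \<beta>) (\<alpha>', \<beta>').
        (compose (carrier (trL D)) \<alpha>' \<alpha>, compose (carrier (trR D)) \<beta> \<beta>'))\<rparr>"

definition Q0_actl :: "('l, 't, 'r, 'z) triad_scheme \<Rightarrow> ('l, 'r) q1 \<Rightarrow> ('l, 'r) q0 \<Rightarrow> ('l, 'r) q0" where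
  "Q0_actl D q = Q0_lift D (Q0_lattice D) (\<lambda>r l. Q0_pure D (snd q r) l)"

definition Q0_actr :: "('l, 't, 'r, 'z) triad_scheme \<Rightarrow> ('l, 'r) q0 \<Rightarrow> ('l, 'r) q1 \<Rightarrow> ('l, 'r) q0" where
  "Q0_actr D c q = Q0_lift D (Q0_lattice D) (\<lambda>r l. Q0_pure D r (fst q l)) c"

definition coupling_phi :: "('l, 't, 'r, 'z) triad_scheme \<Rightarrow> ('l, 'r) q0 \<Rightarrow> ('l, 'r) q1" where
  "coupling_phi D =
     Q0_lift D (Q1 D)
       (\<lambda>r l. (\<lambda>l'\<in>carrier (trL D). actL D (pairing D l' r) l,
               \<lambda>r'\<in>carrier (trR D). actR D r (pairing D l r')))"

text \<open>
  The involutions: \<open>(r \<otimes> l)* = l* \<otimes> r*\<close> and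
  \<open>(\<alpha>, \<beta>)* = (l \<mapsto> (\<beta>(l*))*, r \<mapsto> (\<alpha>(r*))*)\<close>; the latter are the ones for which the actions of
  Q1 satisfy \<open>(qr)* = r*q*\<close> and \<open>(lq)* = q*l*\<close>.
\<close>

definition Q0_star :: "('l, 't, 'r, 'z) inv_triad_scheme \<Rightarrow> ('l, 'r) q0 \<Rightarrow> ('l, 'r) q0" where
  "Q0_star D = Q0_lift D (Q0_lattice D) (\<lambda>r l. Q0_pure D (starL D l) (starR D r))"

definition Q1_star :: "('l, 't, 'r, 'z) inv_triad_scheme \<Rightarrow> ('l, 'r) q1 \<Rightarrow> ('l, 'r) q1" where
  "Q1_star D = (\<lambda>(\<alpha>, \<beta>).
     (\<lambda>l\<in>carrier (trL D). starR D (\<beta> (starL D l)),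
      \<lambda>r\<in>carrier (trR D). starL D (\<alpha> (starR D r))))"


section \<open>Solutions versus factorizations\<close>

text \<open>
  For a fixed involutive quantale \<open>K\<close>, the sets of all involutive solution structures on \<open>K\<close> and of
  all involutive factorizations through \<open>K\<close>. The functions are extensional, so that structures
  agreeing on the carriers are equal.
\<close>

definition involutive_solutions ::
  "('l, 't, 'r, 'z) inv_triad_scheme \<Rightarrow> ('k, 'm) quantale_scheme \<Rightarrow> ('k \<Rightarrow> 'k) \<Rightarrow>
   (('k \<Rightarrow> 'r \<Rightarrow> 'r) \<times> ('l \<Rightarrow> 'k \<Rightarrow> 'l) \<times> ('r \<Rightarrow> 'l \<Rightarrow> 'k)) set" where
  "involutive_solutions D K star =
     {(qR, Lq, RL).
        qR \<in> carrier K \<rightarrow>\<^sub>E carrier (trR D) \<rightarrow>\<^sub>E carrier (trR D) \<and>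
        Lq \<in> carrier (trL D) \<rightarrow>\<^sub>E carrier K \<rightarrow>\<^sub>E carrier (trL D) \<and>
        RL \<in> carrier (trR D) \<rightarrow>\<^sub>E carrier (trL D) \<rightarrow>\<^sub>E carrier K \<and>
        involutive_solution D K qR Lq RL star}"

definition involutive_factorizations ::
  "('l, 't, 'r, 'z) inv_triad_scheme \<Rightarrow> ('k, 'm) quantale_scheme \<Rightarrow> ('k \<Rightarrow> 'k) \<Rightarrow>
   ((('l, 'r) q0 \<Rightarrow> 'k) \<times> ('k \<Rightarrow> ('l, 'r) q1)) set" where
  "involutive_factorizations D K star =
     {(\<phi>0, \<phi>1).
        \<phi>0 \<in> carrier (Q0 D) \<rightarrow>\<^sub>E carrier K \<and>
        \<phi>1 \<in> carrier K \<rightarrow>\<^sub>E carrier (Q1 D) \<and>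
        involutive_couple_factorization (Q0 D) (Q1 D) (Q0_actl D) (Q0_actr D) (coupling_phi D)
          (Q0_star D) (Q1_star D) K \<phi>0 \<phi>1 star}"

text \<open>
  The solution belonging to a factorization: \<open>rl = \<phi>0(r \<otimes> l)\<close>, and \<open>K\<close> acts on L and R through
  \<open>\<phi>1\<close> and the actions of Q1.
\<close>

definition solution_of_factorization ::
  "('l, 't, 'r, 'z) triad_scheme \<Rightarrow> ('k, 'm) quantale_scheme \<Rightarrow>
   (('l, 'r) q0 \<Rightarrow> 'k) \<times> ('k \<Rightarrow> ('l, 'r) q1) \<Rightarrow>
   ('k \<Rightarrow> 'r \<Rightarrow> 'r) \<times> ('l \<Rightarrow> 'k \<Rightarrow> 'l) \<times> ('r \<Rightarrow> 'l \<Rightarrow> 'k)" where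
  "solution_of_factorization D K = (\<lambda>(\<phi>0, \<phi>1).
     (\<lambda>k\<in>carrier K. \<lambda>r\<in>carrier (trR D). snd (\<phi>1 k) r,
      \<lambda>l\<in>carrier (trL D). \<lambda>k\<in>carrier K. fst (\<phi>1 k) l,
      \<lambda>r\<in>carrier (trR D). \<lambda>l\<in>carrier (trL D). \<phi>0 (Q0_pure D r l)))"

end

(*
  Every element of Q0 is a join of pure tensors r \<otimes> l, and a balanced bimorphism on R \<times> L extends
  uniquely to a sup-lattice morphism on Q0. Hence an equation between join-preserving maps on Q0 need
  only be checked on pure tensors, where it is one of the axioms of a triad or of a solution.
  The multiplication of Q0 is c c' = \<phi>(c) c', so its laws follow from those of the action of Q1.
  A factorization (\<phi>0, \<phi>1) through K and a solution on K carry the same data: \<phi>1 is the pair of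
  actions of K on L and R, and \<phi>0 is the morphism extending the balanced bimorphism (r, l) \<mapsto> rl.
*)
theory Submission
  imports Defs
begin

section \<open>Sup-lattices and their morphisms\<close>

text \<open>The obstacle is that every operation on \<open>Q0\<close> is a definite description, the
  product even two nested ones, over a quotient of a quotient of a power set. Once the universal
  property is available, classes are never opened again: a description is evaluated as soon as some
  morphism with the right values on pure tensors is known. Hence the product is not shown to be well
  defined on its own; it is recognised as an action of \<open>Q1\<close>, whose balance is just the
  T-linearity of the maps in \<open>Q1\<close>. The two ends of the coupling are handled dually.
  Maps out of \<open>Q0\<close> are tested on generators, maps into \<open>Q1\<close> on
  coordinates, namely by evaluation at elements of L and R. Both involutions exchange L and R, so
  that of \<open>Q1\<close> must swap the two components of a pair, and that of \<open>Q0\<close>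
  reverses products because the product can be computed by the left as well as by the right
  action.\<close>

lemma complete_lattice_of_sups:
  assumes eq: "eq X = (=)"
    and refl: "\<And>x. x \<in> carrier X \<Longrightarrow> le X x x"
    and antisym: "\<And>x y. \<lbrakk>x \<in> carrier X; y \<in> carrier X; le X x y; le X y x\<rbrakk> \<Longrightarrow> x = y"
    and trans: "\<And>x y z. \<lbrakk>x \<in> carrier X; y \<in> carrier X; z \<in> carrier X; le X x y; le X y z\<rbrakk> \<Longrightarrow> le X x z"
    and closed: "\<And>A. A \<subseteq> carrier X \<Longrightarrow> s A \<in> carrier X"
    and upper: "\<And>A a. \<lbrakk>A \<subseteq> carrier X; a \<in> A\<rbrakk> \<Longrightarrow> le X a (s A)"
    and least: "\<And>A z. \<lbrakk>A \<subseteq> carrier X; z \<in> carrier X; \<And>a. a \<in> A \<Longrightarrow> le X a z\<rbrakk> \<Longrightarrow> le X (s A) z"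
  shows "complete_lattice X"
proof -
  interpret partial_order X
    by unfold_locales (simp_all add: eq refl antisym, blast intro: trans)
  show ?thesis
  proof
    fix A
    assume A: "A \<subseteq> carrier X"
    have "least X (s A) (Upper X A)"
    proof (rule least_UpperI)
      show "s A \<sqsubseteq>\<^bsub>X\<^esub> z" if "z \<in> Upper X A" for z
        using A that by (intro least[OF A]) (auto simp: Upper_def)
    qed (use A in \<open>auto intro: upper closed\<close>)
    then show "\<exists>x. least X x (Upper X A)" ..
    \<comment> \<open>The meet of A is taken to be the join of its lower bounds, so a join operation
      alone yields a complete lattice.\<close>
    have B: "Lower X A \<subseteq> carrier X" by simp
    have "greatest X (s (Lower X A)) (Lower X A)"
    proof (rule greatest_LowerI)
      show "s (Lower X A) \<sqsubseteq>\<^bsub>X\<^esub> x" if "x \<in> A" for x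
        using A that by (intro least[OF B]) auto
    qed (use A B in \<open>auto intro: upper closed\<close>)
    then show "\<exists>x. greatest X x (Lower X A)" ..
  qed
qed

lemma sup_le_iff:
  assumes "complete_lattice X" "A \<subseteq> carrier X" "z \<in> carrier X"
  shows "(\<Squnion>\<^bsub>X\<^esub>A) \<sqsubseteq>\<^bsub>X\<^esub> z \<longleftrightarrow> (\<forall>a\<in>A. a \<sqsubseteq>\<^bsub>X\<^esub> z)"
proof -
  interpret complete_lattice X by fact
  show ?thesis
    using assms(2,3) sup_upper sup_least sup_closed le_trans by (meson subsetD)
qed

lemma sup_in_carrier:
  assumes "complete_lattice X" "A \<subseteq> carrier X"
  shows "(\<Squnion>\<^bsub>X\<^esub>A) \<in> carrier X"
proof -
  interpret complete_lattice X by fact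
  show ?thesis using assms(2) by simp
qed

text \<open>Taking z to be x and then y gives both inequalities. Joins are choice terms in
  HOL-Algebra, so identities between them are best proved by comparing upper bounds.\<close>

lemma eq_by_upper_bounds:
  assumes "complete_lattice X" "x \<in> carrier X" "y \<in> carrier X"
    "\<And>z. z \<in> carrier X \<Longrightarrow> x \<sqsubseteq>\<^bsub>X\<^esub> z \<longleftrightarrow> y \<sqsubseteq>\<^bsub>X\<^esub> z"
  shows "x = y"
proof -
  interpret complete_lattice X by fact
  show ?thesis using assms(2-) by blast
qed

lemma sup_eqI:
  assumes "complete_lattice X" "A \<subseteq> carrier X" "x \<in> carrier X"
    "\<And>z. z \<in> carrier X \<Longrightarrow> x \<sqsubseteq>\<^bsub>X\<^esub> z \<longleftrightarrow> (\<forall>a\<in>A. a \<sqsubseteq>\<^bsub>X\<^esub> z)"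
  shows "(\<Squnion>\<^bsub>X\<^esub>A) = x"
  using assms by (intro eq_by_upper_bounds[of X]) (auto simp: sup_le_iff sup_in_carrier)

lemma sup_singleton:
  assumes "complete_lattice X" "x \<in> carrier X"
  shows "(\<Squnion>\<^bsub>X\<^esub>{x}) = x"
  using assms by (intro sup_eqI) auto

lemma sup_pair_eq:
  assumes X: "complete_lattice X" and "x \<in> carrier X" "y \<in> carrier X" "x \<sqsubseteq>\<^bsub>X\<^esub> y"
  shows "(\<Squnion>\<^bsub>X\<^esub>{x, y}) = y"
proof -
  interpret complete_lattice X by fact
  show ?thesis using assms by (intro sup_eqI) (auto intro: le_trans)
qed

text \<open>The least-upper-bound property mentions only carrier and order. This transfers joins
  between records of different types, such as \<open>Q0_lattice\<close> and
  \<open>Q0\<close>.\<close>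

lemma sup_extend_cong:
  assumes "carrier X = carrier Y" "le X = le Y"
  shows "(\<Squnion>\<^bsub>X\<^esub>A) = \<Squnion>\<^bsub>Y\<^esub>A"
  using assms by (simp add: Lattice.sup_def least_def Upper_def)

lemma sup_morphismI:
  assumes "\<And>x. x \<in> carrier X \<Longrightarrow> f x \<in> carrier Y"
    "\<And>A. A \<subseteq> carrier X \<Longrightarrow> f (\<Squnion>\<^bsub>X\<^esub>A) = \<Squnion>\<^bsub>Y\<^esub>(f ` A)"
  shows "sup_morphism X Y f"
  using assms by (auto simp: sup_morphism_def)

lemma sup_morphism_closed: "\<lbrakk>sup_morphism X Y f; x \<in> carrier X\<rbrakk> \<Longrightarrow> f x \<in> carrier Y"
  by (auto simp: sup_morphism_def)

lemma sup_morphism_sup: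
  "\<lbrakk>sup_morphism X Y f; A \<subseteq> carrier X\<rbrakk> \<Longrightarrow> f (\<Squnion>\<^bsub>X\<^esub>A) = \<Squnion>\<^bsub>Y\<^esub>(f ` A)"
  by (auto simp: sup_morphism_def)

lemma sup_morphism_comp:
  assumes "sup_morphism X Y f" "sup_morphism Y Z g"
  shows "sup_morphism X Z (\<lambda>x. g (f x))"
proof (rule sup_morphismI)
  fix A assume A: "A \<subseteq> carrier X"
  then have "f ` A \<subseteq> carrier Y" using assms by (auto simp: sup_morphism_def)
  then show "g (f (\<Squnion>\<^bsub>X\<^esub>A)) = \<Squnion>\<^bsub>Z\<^esub>((\<lambda>x. g (f x)) ` A)"
    using assms A by (simp add: sup_morphism_def image_image)
qed (use assms in \<open>auto simp: sup_morphism_def\<close>)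

lemma sup_morphism_cong:
  assumes "complete_lattice X" "\<And>x. x \<in> carrier X \<Longrightarrow> f x = g x"
  shows "sup_morphism X Y f \<longleftrightarrow> sup_morphism X Y g"
proof -
  have "f ` A = g ` A" if "A \<subseteq> carrier X" for A using that assms(2) by (intro image_cong) auto
  then show ?thesis
    using assms(2) sup_in_carrier[OF assms(1)] by (auto simp: sup_morphism_def Pi_iff)
qed

lemma sup_morphism_id: "sup_morphism X X (\<lambda>x. x)"
  by (simp add: sup_morphism_def)

text \<open>Joins commute with joins: both sides are bounded by z exactly when all
  \<open>f i x\<close> with i in I and x in A are. It is used for joins in \<open>Q1\<close> and for
  passing from pure tensors to all of \<open>Q0\<close> in \<open>bimorphism_Q0I\<close>.\<close>

lemma sup_morphism_pointwise_sup:
  assumes Y: "complete_lattice Y" and f: "\<And>i. i \<in> I \<Longrightarrow> sup_morphism X Y (f i)"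
    and X: "complete_lattice X"
  shows "sup_morphism X Y (\<lambda>x. \<Squnion>\<^bsub>Y\<^esub>((\<lambda>i. f i x) ` I))"
proof (rule sup_morphismI)
  have sub: "(\<lambda>i. f i x) ` I \<subseteq> carrier Y" if "x \<in> carrier X" for x
    using f that by (auto intro: sup_morphism_closed)
  then show *: "(\<Squnion>\<^bsub>Y\<^esub>((\<lambda>i. f i x) ` I)) \<in> carrier Y" if "x \<in> carrier X" for x
    using that by (simp add: Y sup_in_carrier)
  fix A assume A: "A \<subseteq> carrier X"
  have sA: "(\<Squnion>\<^bsub>X\<^esub>A) \<in> carrier X" using X A by (rule sup_in_carrier)
  have img: "f i ` A \<subseteq> carrier Y" if "i \<in> I" for i
    using f[OF that] A by (auto intro: sup_morphism_closed)
  show "(\<Squnion>\<^bsub>Y\<^esub>((\<lambda>i. f i (\<Squnion>\<^bsub>X\<^esub>A)) ` I)) = \<Squnion>\<^bsub>Y\<^esub>((\<lambda>x. \<Squnion>\<^bsub>Y\<^esub>((\<lambda>i. f i x) ` I)) ` A)"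
  proof (rule eq_by_upper_bounds[OF Y])
    fix z assume z: "z \<in> carrier Y"
    have "(\<Squnion>\<^bsub>Y\<^esub>((\<lambda>i. f i (\<Squnion>\<^bsub>X\<^esub>A)) ` I)) \<sqsubseteq>\<^bsub>Y\<^esub> z \<longleftrightarrow> (\<forall>i\<in>I. \<forall>x\<in>A. f i x \<sqsubseteq>\<^bsub>Y\<^esub> z)"
      unfolding sup_le_iff[OF Y sub[OF sA] z]
      using sup_le_iff[OF Y img z] by (simp add: sup_morphism_sup[OF f A])
    also have "\<dots> \<longleftrightarrow> (\<Squnion>\<^bsub>Y\<^esub>((\<lambda>x. \<Squnion>\<^bsub>Y\<^esub>((\<lambda>i. f i x) ` I)) ` A)) \<sqsubseteq>\<^bsub>Y\<^esub> z"
    proof -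
      have "(\<lambda>x. \<Squnion>\<^bsub>Y\<^esub>((\<lambda>i. f i x) ` I)) ` A \<subseteq> carrier Y" using * A by blast
      moreover have "(\<Squnion>\<^bsub>Y\<^esub>((\<lambda>i. f i x) ` I)) \<sqsubseteq>\<^bsub>Y\<^esub> z \<longleftrightarrow> (\<forall>i\<in>I. f i x \<sqsubseteq>\<^bsub>Y\<^esub> z)" if "x \<in> A" for x
        using sup_le_iff[OF Y sub z, of x] A that by auto
      ultimately show ?thesis by (auto simp: sup_le_iff[OF Y _ z])
    qed
    finally show "(\<Squnion>\<^bsub>Y\<^esub>((\<lambda>i. f i (\<Squnion>\<^bsub>X\<^esub>A)) ` I)) \<sqsubseteq>\<^bsub>Y\<^esub> z \<longleftrightarrow>
      (\<Squnion>\<^bsub>Y\<^esub>((\<lambda>x. \<Squnion>\<^bsub>Y\<^esub>((\<lambda>i. f i x) ` I)) ` A)) \<sqsubseteq>\<^bsub>Y\<^esub> z" .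
  qed (use * sA A in \<open>auto intro!: sup_in_carrier[OF Y] sup_morphism_closed[OF f]\<close>)
qed

lemma bimorphism_flip: "bimorphism X Y Z b \<longleftrightarrow> bimorphism Y X Z (\<lambda>y x. b x y)"
  by (auto simp: bimorphism_def)

lemma bimorphism_left: "\<lbrakk>bimorphism X Y Z b; y \<in> carrier Y\<rbrakk> \<Longrightarrow> sup_morphism X Z (\<lambda>x. b x y)"
  by (simp add: bimorphism_def)

lemma bimorphism_right: "\<lbrakk>bimorphism X Y Z b; x \<in> carrier X\<rbrakk> \<Longrightarrow> sup_morphism Y Z (b x)"
  by (simp add: bimorphism_def)

lemma bimorphism_closed:
  "\<lbrakk>bimorphism X Y Z b; x \<in> carrier X; y \<in> carrier Y\<rbrakk> \<Longrightarrow> b x y \<in> carrier Z"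
  by (auto simp: bimorphism_def sup_morphism_def)

lemma bimorphism_comp_left:
  assumes "sup_morphism X X' f" "bimorphism X' Y Z b"
  shows "bimorphism X Y Z (\<lambda>x y. b (f x) y)"
  using assms unfolding bimorphism_def
  by (auto intro: sup_morphism_comp[of X X' f Z] simp: sup_morphism_closed)

lemma bimorphism_comp_right:
  assumes "sup_morphism Y Y' g" "bimorphism X Y' Z b"
  shows "bimorphism X Y Z (\<lambda>x y. b x (g y))"
  using assms unfolding bimorphism_def
  by (auto intro: sup_morphism_comp[of Y Y' g Z] simp: sup_morphism_closed)

lemma bimorphism_comp:
  assumes "bimorphism X Y Z b" "sup_morphism Z Z' h"
  shows "bimorphism X Y Z' (\<lambda>x y. h (b x y))"
  using assms unfolding bimorphism_def
  by (auto intro: sup_morphism_comp[of _ Z _ Z' h])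

lemma bimorphism_cong:
  assumes "complete_lattice X" "complete_lattice Y"
    "\<And>x y. \<lbrakk>x \<in> carrier X; y \<in> carrier Y\<rbrakk> \<Longrightarrow> b x y = b' x y"
  shows "bimorphism X Y Z b \<longleftrightarrow> bimorphism X Y Z b'"
  unfolding bimorphism_def
  using sup_morphism_cong[OF assms(1), of "\<lambda>x. b x y" "\<lambda>x. b' x y" Z for y]
    sup_morphism_cong[OF assms(2), of "\<lambda>y. b x y" "\<lambda>y. b' x y" Z for x] assms(3)
  by (auto cong: ball_cong)


section \<open>Quotients of sup-lattices\<close>

lemma sup_congruence_Inter:
  assumes "\<E> \<noteq> {}" "\<And>E. E \<in> \<E> \<Longrightarrow> sup_congruence X E"
  shows "sup_congruence X (\<Inter>\<E>)"
proof -
  have E: "equiv (carrier X) E" "\<And>P. P \<subseteq> E \<Longrightarrow> (\<Squnion>\<^bsub>X\<^esub>(fst ` P), \<Squnion>\<^bsub>X\<^esub>(snd ` P)) \<in> E" if "E \<in> \<E>" for E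
    using assms(2)[OF that] by (auto simp: sup_congruence_def)
  have "equiv (carrier X) (\<Inter>\<E>)"
    using assms(1) E(1) unfolding equiv_def refl_on_def sym_def trans_def
    by (intro conjI) (blast+)
  then show ?thesis using E(2) by (auto simp: sup_congruence_def)
qed

text \<open>This witness makes the family intersected in \<open>generated_congruence\<close>
  nonempty; the empty intersection would be the universal relation of the type instead of a
  congruence on the carrier.\<close>

lemma sup_congruence_total:
  assumes "complete_lattice X"
  shows "sup_congruence X (carrier X \<times> carrier X)"
  unfolding sup_congruence_def
proof (intro conjI allI impI)
  show "equiv (carrier X) (carrier X \<times> carrier X)"
    by (auto simp: equiv_def refl_on_def sym_def trans_def)
  fix P assume "P \<subseteq> carrier X \<times> carrier X"
  then have "fst ` P \<subseteq> carrier X" "snd ` P \<subseteq> carrier X" by auto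
  then show "(\<Squnion>\<^bsub>X\<^esub>(fst ` P), \<Squnion>\<^bsub>X\<^esub>(snd ` P)) \<in> carrier X \<times> carrier X"
    using assms by (simp add: sup_in_carrier)
qed

lemma sup_congruence_generated:
  assumes "complete_lattice X" "G \<subseteq> carrier X \<times> carrier X"
  shows "sup_congruence X (generated_congruence X G)"
  unfolding generated_congruence_def
  by (rule sup_congruence_Inter) (use sup_congruence_total[OF assms(1)] assms(2) in auto)

lemma generated_congruence_contains: "p \<in> G \<Longrightarrow> p \<in> generated_congruence X G"
  by (auto simp: generated_congruence_def)

lemma generated_congruence_least:
  "\<lbrakk>sup_congruence X E; G \<subseteq> E\<rbrakk> \<Longrightarrow> generated_congruence X G \<subseteq> E"
  by (auto simp: generated_congruence_def)

text \<open>Families that h identifies pairwise have the same image set, hence joins with the same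
  value. Kernels are what generated congruences are compared with: a generated congruence lies
  inside every kernel that contains its generators.\<close>

lemma sup_congruence_kernel:
  assumes X: "complete_lattice X" and h: "sup_morphism X Y h"
  shows "sup_congruence X {(a, b). a \<in> carrier X \<and> b \<in> carrier X \<and> h a = h b}"
    (is "sup_congruence X ?E")
  unfolding sup_congruence_def
proof (intro conjI allI impI)
  show "equiv (carrier X) ?E"
    by (auto simp: equiv_def refl_on_def sym_def trans_def)
  fix P assume P: "P \<subseteq> ?E"
  then have c: "fst ` P \<subseteq> carrier X" "snd ` P \<subseteq> carrier X" by auto
  have "h ` fst ` P = h ` snd ` P"
    unfolding image_image by (rule image_cong) (use P in auto)
  then show "(\<Squnion>\<^bsub>X\<^esub>(fst ` P), \<Squnion>\<^bsub>X\<^esub>(snd ` P)) \<in> ?E"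
    using c h X by (simp add: sup_in_carrier sup_morphism_sup)
qed

locale sup_lattice_congruence = complete_lattice X for X (structure) +
  fixes E
  assumes congruence: "sup_congruence X E"
begin

lemma equiv_E: "equiv (carrier X) E"
  using congruence by (simp add: sup_congruence_def)

lemma E_carrier: "(a, b) \<in> E \<Longrightarrow> a \<in> carrier X \<and> b \<in> carrier X"
  using equiv_E by (auto simp: equiv_def refl_on_def)

lemma E_refl: "a \<in> carrier X \<Longrightarrow> (a, a) \<in> E"
  using equiv_E by (auto simp: equiv_def refl_on_def)

lemma E_sym: "(a, b) \<in> E \<Longrightarrow> (b, a) \<in> E"
  using equiv_E by (auto simp: equiv_def sym_def)

lemma E_trans: "\<lbrakk>(a, b) \<in> E; (b, c) \<in> E\<rbrakk> \<Longrightarrow> (a, c) \<in> E"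
  using equiv_E by (auto simp: equiv_def trans_def)

lemma E_sup: "P \<subseteq> E \<Longrightarrow> (\<Squnion>(fst ` P), \<Squnion>(snd ` P)) \<in> E"
  using congruence by (simp add: sup_congruence_def)

lemma E_sup_family:
  assumes "\<And>i. i \<in> I \<Longrightarrow> (f i, g i) \<in> E"
  shows "(\<Squnion>(f ` I), \<Squnion>(g ` I)) \<in> E"
  using E_sup[of "(\<lambda>i. (f i, g i)) ` I"] assms by (auto simp: image_image)

lemma E_join:
  assumes "(a, a') \<in> E" "(b, b') \<in> E"
  shows "(\<Squnion>{a, b}, \<Squnion>{a', b'}) \<in> E"
  using E_sup[of "{(a, a'), (b, b')}"] assms by simp

abbreviation XE where "XE \<equiv> sup_quotient X E"

definition cls where "cls a = E `` {a}"

lemma cls_eq_iff: "\<lbrakk>a \<in> carrier X; b \<in> carrier X\<rbrakk> \<Longrightarrow> cls a = cls b \<longleftrightarrow> (a, b) \<in> E"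
  unfolding cls_def by (rule eq_equiv_class_iff[OF equiv_E])

lemma cls_carrier: "a \<in> carrier X \<Longrightarrow> cls a \<in> carrier XE"
  unfolding cls_def by (auto simp: sup_quotient_def intro: quotientI)

lemma carrier_quotient: "carrier XE = cls ` carrier X"
  by (auto simp: sup_quotient_def quotient_def cls_def)

lemma mem_cls: "b \<in> cls a \<longleftrightarrow> (a, b) \<in> E"
  by (auto simp: cls_def)

text \<open>This removes the existential choice of representatives from the order of
  \<open>sup_quotient\<close>. If a' lies below b' for representatives, joining the two equivalences
  relates the join of a and b to b' and so to b. Conversely that join is itself a representative of
  the class of b lying above a.\<close>

lemma le_cls_iff:
  assumes "a \<in> carrier X" "b \<in> carrier X"
  shows "cls a \<sqsubseteq>\<^bsub>XE\<^esub> cls b \<longleftrightarrow> (\<Squnion>{a, b}, b) \<in> E"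
proof
  assume "cls a \<sqsubseteq>\<^bsub>XE\<^esub> cls b"
  then obtain a' b' where ab: "(a, a') \<in> E" "(b, b') \<in> E" "a' \<sqsubseteq> b'"
    by (auto simp: sup_quotient_def mem_cls)
  then have "\<Squnion>{a', b'} = b'"
    using E_carrier complete_lattice_axioms by (blast intro: sup_pair_eq)
  then show "(\<Squnion>{a, b}, b) \<in> E" using E_join[OF ab(1,2)] ab(2) E_sym E_trans by metis
next
  assume "(\<Squnion>{a, b}, b) \<in> E"
  moreover have "a \<sqsubseteq> \<Squnion>{a, b}" using assms by (intro sup_upper) auto
  ultimately show "cls a \<sqsubseteq>\<^bsub>XE\<^esub> cls b"
    using E_refl[OF assms(1)] E_sym by (fastforce simp: sup_quotient_def mem_cls)
qed

lemma cls_mono: "\<lbrakk>a \<in> carrier X; b \<in> carrier X; a \<sqsubseteq> b\<rbrakk> \<Longrightarrow> cls a \<sqsubseteq>\<^bsub>XE\<^esub> cls b"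
  by (simp add: le_cls_iff sup_pair_eq[OF complete_lattice_axioms] E_refl)

lemma cls_sup_le:
  assumes A: "A \<subseteq> carrier X" and b: "b \<in> carrier X" and le: "\<And>a. a \<in> A \<Longrightarrow> cls a \<sqsubseteq>\<^bsub>XE\<^esub> cls b"
  shows "cls (\<Squnion>A) \<sqsubseteq>\<^bsub>XE\<^esub> cls b"
proof -
  let ?f = "\<lambda>a. \<Squnion>{a, b}"
  \<comment> \<open>Each join of a with b is related to b, so the join of all of them is related to
    the join of copies of b. Inserting b keeps the index set nonempty: for empty A the join of the
    constant family would be the bottom element and not b.\<close>
  let ?I = "insert b A"
  have "(\<Squnion>(?f ` ?I), \<Squnion>((\<lambda>_. b) ` ?I)) \<in> E"
    using le A b by (intro E_sup_family) (auto simp: le_cls_iff[symmetric] subset_eq E_refl)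
  moreover have "(\<Squnion>((\<lambda>_. b) ` ?I)) = b" using b by (simp add: image_constant_conv)
  moreover have "(\<Squnion>(?f ` ?I)) = \<Squnion>{\<Squnion>A, b}"
  proof (rule sup_eqI[OF complete_lattice_axioms])
    show "?f ` ?I \<subseteq> carrier X" using A b by (auto intro!: sup_closed)
    show "(\<Squnion>{\<Squnion>A, b}) \<in> carrier X" using A b by (auto intro!: sup_closed)
    fix z assume z: "z \<in> carrier X"
    have "(\<Squnion>{a, b}) \<sqsubseteq> z \<longleftrightarrow> a \<sqsubseteq> z \<and> b \<sqsubseteq> z" if "a \<in> carrier X" for a
      using sup_le_iff[OF complete_lattice_axioms _ z, of "{a, b}"] that b by auto
    then show "(\<Squnion>{\<Squnion>A, b}) \<sqsubseteq> z \<longleftrightarrow> (\<forall>x\<in>?f ` ?I. x \<sqsubseteq> z)"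
      using A b sup_le_iff[OF complete_lattice_axioms A z] by (auto simp: subset_eq)
  qed
  ultimately show ?thesis using A b by (simp add: le_cls_iff)
qed

lemma quotient_complete_lattice: "complete_lattice XE"
proof -
  \<comment> \<open>\<open>\<rho>\<close> selects one representative per class, so that a family of
    classes can be joined in X. No independence of the choice has to be shown beforehand, since the
    resulting class is verified directly to be the least upper bound.\<close>
  define \<rho> where "\<rho> U = (SOME a. a \<in> carrier X \<and> U = cls a)" for U
  have \<rho>: "\<rho> U \<in> carrier X \<and> cls (\<rho> U) = U" if "U \<in> carrier XE" for U
    using someI_ex[of "\<lambda>a. a \<in> carrier X \<and> U = cls a"] that unfolding \<rho>_def carrier_quotient by auto
  have \<rho>A: "\<rho> ` A \<subseteq> carrier X" if "A \<subseteq> carrier XE" for A using that \<rho> by auto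
  show ?thesis
  proof (rule complete_lattice_of_sups[where s = "\<lambda>A. cls (\<Squnion>(\<rho> ` A))"])
    show "eq XE = (=)" by (simp add: sup_quotient_def)
    show "U \<sqsubseteq>\<^bsub>XE\<^esub> U" if "U \<in> carrier XE" for U
      using that by (auto simp: carrier_quotient intro: cls_mono)
    show "U = V" if UV: "U \<in> carrier XE" "V \<in> carrier XE" "U \<sqsubseteq>\<^bsub>XE\<^esub> V" "V \<sqsubseteq>\<^bsub>XE\<^esub> U" for U V
    proof -
      obtain a b where ab: "U = cls a" "V = cls b" "a \<in> carrier X" "b \<in> carrier X"
        using UV(1,2) by (auto simp: carrier_quotient)
      have "(\<Squnion>{a, b}, b) \<in> E" "(\<Squnion>{b, a}, a) \<in> E"
        using UV(3,4) unfolding ab(1,2) by (simp_all only: le_cls_iff[OF ab(3,4)] le_cls_iff[OF ab(4,3)])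
      then have "(a, b) \<in> E" using E_sym E_trans by (metis insert_commute)
      then show ?thesis using ab by (simp add: cls_eq_iff)
    qed
    show "U \<sqsubseteq>\<^bsub>XE\<^esub> W" if UVW: "U \<in> carrier XE" "V \<in> carrier XE" "W \<in> carrier XE"
      "U \<sqsubseteq>\<^bsub>XE\<^esub> V" "V \<sqsubseteq>\<^bsub>XE\<^esub> W" for U V W
    proof -
      \<comment> \<open>The two comparisons may use different representatives b and b' of the middle
        class. Joining with c bridges the gap: a lies below the join of b and c, which is related to
        the join of b' and c, and that is c.\<close>
      obtain a b b' c where *: "U = cls a" "a \<in> carrier X" "a \<sqsubseteq> b" "(b, b') \<in> E" "b' \<sqsubseteq> c"
          "W = cls c" "c \<in> carrier X"
      proof -
        obtain u v w where uvw: "U = cls u" "V = cls v" "W = cls w"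
            "u \<in> carrier X" "v \<in> carrier X" "w \<in> carrier X"
          using UVW by (auto simp: carrier_quotient)
        obtain a b where ab: "(u, a) \<in> E" "(v, b) \<in> E" "a \<sqsubseteq> b"
          using UVW(4) uvw by (auto simp: sup_quotient_def mem_cls)
        obtain b' c where bc: "(v, b') \<in> E" "(w, c) \<in> E" "b' \<sqsubseteq> c"
          using UVW(5) uvw by (auto simp: sup_quotient_def mem_cls)
        have "a \<in> carrier X" "c \<in> carrier X" using ab bc E_carrier by auto
        moreover have "cls u = cls a" "cls w = cls c"
          using ab bc E_carrier cls_eq_iff by blast+
        moreover have "(b, b') \<in> E" using ab bc E_sym E_trans by blast
        ultimately show ?thesis using ab bc uvw by (intro that[of a b b' c]) simp_all
      qed
      have car: "b \<in> carrier X" "b' \<in> carrier X" using *(4) E_carrier by auto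
      have "a \<sqsubseteq> \<Squnion>{b, c}"
        using *(2,3,7) car sup_upper[of "{b, c}" b] sup_closed[of "{b, c}"] le_trans by auto
      then have "cls a \<sqsubseteq>\<^bsub>XE\<^esub> cls (\<Squnion>{b, c})" using *(2,7) car by (intro cls_mono) auto
      also have "cls (\<Squnion>{b, c}) = cls c"
      proof -
        have "(\<Squnion>{b, c}, \<Squnion>{b', c}) \<in> E" using *(4,7) by (intro E_join E_refl)
        moreover have "(\<Squnion>{b', c}) = c"
          using *(5,7) car by (intro sup_pair_eq[OF complete_lattice_axioms])
        ultimately show ?thesis using *(7) car by (simp add: cls_eq_iff)
      qed
      finally show ?thesis using * by simp
    qed
    show "cls (\<Squnion>(\<rho> ` A)) \<in> carrier XE" if "A \<subseteq> carrier XE" for A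
      using \<rho>A[OF that] by (simp add: cls_carrier)
    show "U \<sqsubseteq>\<^bsub>XE\<^esub> cls (\<Squnion>(\<rho> ` A))" if "A \<subseteq> carrier XE" "U \<in> A" for A U
    proof -
      have "cls (\<rho> U) \<sqsubseteq>\<^bsub>XE\<^esub> cls (\<Squnion>(\<rho> ` A))"
        using \<rho>A[OF that(1)] that(2) by (intro cls_mono sup_upper) auto
      then show ?thesis using \<rho> that by auto
    qed
    show "cls (\<Squnion>(\<rho> ` A)) \<sqsubseteq>\<^bsub>XE\<^esub> W"
      if "A \<subseteq> carrier XE" "W \<in> carrier XE" "\<And>U. U \<in> A \<Longrightarrow> U \<sqsubseteq>\<^bsub>XE\<^esub> W" for A W
    proof -
      have "cls (\<Squnion>(\<rho> ` A)) \<sqsubseteq>\<^bsub>XE\<^esub> cls (\<rho> W)"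
        using \<rho>A[OF that(1)] \<rho> that by (intro cls_sup_le) (auto simp: subset_eq)
      then show ?thesis using \<rho> that(2) by auto
    qed
  qed
qed

lemma cls_sup_morphism: "sup_morphism X XE cls"
proof (rule sup_morphismI)
  fix A assume A: "A \<subseteq> carrier X"
  interpret XE: complete_lattice XE by (rule quotient_complete_lattice)
  show "cls (\<Squnion>A) = \<Squnion>\<^bsub>XE\<^esub>(cls ` A)"
  proof (rule sup_eqI[OF quotient_complete_lattice, symmetric])
    show "cls ` A \<subseteq> carrier XE" "cls (\<Squnion>A) \<in> carrier XE" using A by (auto simp: cls_carrier)
    fix W assume "W \<in> carrier XE"
    then obtain b where b: "W = cls b" "b \<in> carrier X" by (auto simp: carrier_quotient)
    show "cls (\<Squnion>A) \<sqsubseteq>\<^bsub>XE\<^esub> W \<longleftrightarrow> (\<forall>U\<in>cls ` A. U \<sqsubseteq>\<^bsub>XE\<^esub> W)"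
    proof
      assume *: "cls (\<Squnion>A) \<sqsubseteq>\<^bsub>XE\<^esub> W"
      have "cls a \<sqsubseteq>\<^bsub>XE\<^esub> cls (\<Squnion>A)" if "a \<in> A" for a
        using A that by (intro cls_mono sup_upper) auto
      then show "\<forall>U\<in>cls ` A. U \<sqsubseteq>\<^bsub>XE\<^esub> W"
        using * A b by (auto intro: XE.le_trans[of _ "cls (\<Squnion>A)"] simp: subset_eq cls_carrier)
    qed (use A b in \<open>auto intro: cls_sup_le\<close>)
  qed
qed (simp add: cls_carrier)

text \<open>The existence half of the universal property. For the join law, a family of classes is
  written as the image of a family in X, whose join \<open>cls\<close> preserves.\<close>

lemma quotient_lift:
  assumes h: "sup_morphism X Y h" and E: "\<And>a b. (a, b) \<in> E \<Longrightarrow> h a = h b"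
  obtains f where "sup_morphism XE Y f" "\<And>a. a \<in> carrier X \<Longrightarrow> f (cls a) = h a"
proof
  define f where "f U = h (SOME a. a \<in> U)" for U
  show f: "f (cls a) = h a" if "a \<in> carrier X" for a
  proof -
    have "(a, SOME b. b \<in> cls a) \<in> E"
      using someI[of "\<lambda>b. b \<in> cls a" a] E_refl[OF that] by (simp add: mem_cls)
    then show ?thesis by (simp add: f_def E)
  qed
  show "sup_morphism XE Y f"
  proof (rule sup_morphismI)
    show "f U \<in> carrier Y" if "U \<in> carrier XE" for U
      using that f h by (auto simp: carrier_quotient sup_morphism_closed)
    fix B assume "B \<subseteq> carrier XE"
    then obtain A where A: "A \<subseteq> carrier X" "B = cls ` A"
      by (auto simp: carrier_quotient subset_image_iff)
    have "f (\<Squnion>\<^bsub>XE\<^esub>B) = f (cls (\<Squnion>A))"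
      using A by (simp add: sup_morphism_sup[OF cls_sup_morphism])
    also have "\<dots> = \<Squnion>\<^bsub>Y\<^esub>(h ` A)" using A h by (simp add: f sup_morphism_sup)
    also have "h ` A = f ` B" using A f by (auto simp: image_iff subset_eq)
    finally show "f (\<Squnion>\<^bsub>XE\<^esub>B) = \<Squnion>\<^bsub>Y\<^esub>(f ` B)" .
  qed
qed

end

text \<open>The kernel of h is a congruence containing G, hence contains the least such congruence.
  Compatibility of a morphism with the relation is thereby reduced to the generators.\<close>

lemma generated_congruence_respects:
  assumes "complete_lattice X" "sup_morphism X Y h" "G \<subseteq> carrier X \<times> carrier X"
    "\<And>a b. (a, b) \<in> G \<Longrightarrow> h a = h b" "(a, b) \<in> generated_congruence X G"
  shows "h a = h b"
  using generated_congruence_least[OF sup_congruence_kernel[OF assms(1,2)], of G] assms(3-) by blast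

lemma powerset_complete_lattice: "complete_lattice (powerset_lattice S)"
  by (rule complete_lattice_of_sups[where s = "\<lambda>A. \<Union>A"]) (auto simp: powerset_lattice_def Sup_le_iff)

lemma powerset_sup: "A \<subseteq> Pow S \<Longrightarrow> (\<Squnion>\<^bsub>powerset_lattice S\<^esub>A) = \<Union>A"
  by (rule sup_eqI[OF powerset_complete_lattice]) (auto simp: powerset_lattice_def)


section \<open>Tensor products of sup-lattices\<close>

lemma tensor_generators_carrier:
  assumes "complete_lattice X" "complete_lattice Y"
  shows "{({(\<Squnion>\<^bsub>X\<^esub>A, y)}, A \<times> {y}) | A y. A \<subseteq> carrier X \<and> y \<in> carrier Y} \<union>
         {({(x, \<Squnion>\<^bsub>Y\<^esub>B)}, {x} \<times> B) | x B. x \<in> carrier X \<and> B \<subseteq> carrier Y}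
    \<subseteq> carrier (powerset_lattice (carrier X \<times> carrier Y)) \<times> carrier (powerset_lattice (carrier X \<times> carrier Y))"
  using sup_in_carrier[OF assms(1)] sup_in_carrier[OF assms(2)] by (auto simp: powerset_lattice_def)

lemma tensor_sup_lattice_congruence:
  assumes "complete_lattice X" "complete_lattice Y"
  shows "sup_lattice_congruence (powerset_lattice (carrier X \<times> carrier Y)) (tensor_congruence X Y)"
  unfolding tensor_congruence_def
  by (intro sup_lattice_congruence.intro sup_lattice_congruence_axioms.intro sup_congruence_generated
      powerset_complete_lattice tensor_generators_carrier assms)

lemma tensor_complete_lattice:
  assumes "complete_lattice X" "complete_lattice Y"
  shows "complete_lattice (tensor X Y)"
  unfolding tensor_def
  using sup_lattice_congruence.quotient_complete_lattice[OF tensor_sup_lattice_congruence[OF assms]] .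

text \<open>The power set is the free sup-lattice on S: any map g extends by joining its values,
  because a join over a union is the join of the joins over its members.\<close>

lemma sup_morphism_from_powerset:
  assumes Z: "complete_lattice Z" and g: "\<And>p. p \<in> S \<Longrightarrow> g p \<in> carrier Z"
  shows "sup_morphism (powerset_lattice S) Z (\<lambda>P. \<Squnion>\<^bsub>Z\<^esub>(g ` P))"
proof (rule sup_morphismI)
  show *: "(\<Squnion>\<^bsub>Z\<^esub>(g ` P)) \<in> carrier Z" if "P \<in> carrier (powerset_lattice S)" for P
    using that g by (auto intro!: sup_in_carrier[OF Z] simp: powerset_lattice_def)
  fix \<A> assume "\<A> \<subseteq> carrier (powerset_lattice S)"
  then have A: "\<A> \<subseteq> Pow S" by (simp add: powerset_lattice_def)
  show "(\<Squnion>\<^bsub>Z\<^esub>(g ` (\<Squnion>\<^bsub>powerset_lattice S\<^esub>\<A>))) = \<Squnion>\<^bsub>Z\<^esub>((\<lambda>P. \<Squnion>\<^bsub>Z\<^esub>(g ` P)) ` \<A>)"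
    unfolding powerset_sup[OF A]
  proof (rule sup_eqI[OF Z])
    fix z assume z: "z \<in> carrier Z"
    have "(\<Squnion>\<^bsub>Z\<^esub>(g ` P)) \<sqsubseteq>\<^bsub>Z\<^esub> z \<longleftrightarrow> (\<forall>p\<in>P. g p \<sqsubseteq>\<^bsub>Z\<^esub> z)" if "P \<in> \<A>" for P
      using sup_le_iff[OF Z _ z, of "g ` P"] A that g by auto
    moreover have "(\<lambda>P. \<Squnion>\<^bsub>Z\<^esub>(g ` P)) ` \<A> \<subseteq> carrier Z"
      using * A by (auto simp: powerset_lattice_def)
    ultimately show "(\<Squnion>\<^bsub>Z\<^esub>((\<lambda>P. \<Squnion>\<^bsub>Z\<^esub>(g ` P)) ` \<A>)) \<sqsubseteq>\<^bsub>Z\<^esub> z \<longleftrightarrow> (\<forall>a\<in>g ` \<Union>\<A>. a \<sqsubseteq>\<^bsub>Z\<^esub> z)"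
      by (auto simp: sup_le_iff[OF Z _ z])
  next
    have S: "p \<in> S" if "P \<in> \<A>" "p \<in> P" for p P using A that by auto
    show "g ` \<Union>\<A> \<subseteq> carrier Z" "(\<Squnion>\<^bsub>Z\<^esub>((\<lambda>P. \<Squnion>\<^bsub>Z\<^esub>(g ` P)) ` \<A>)) \<in> carrier Z"
      using S by (auto intro!: sup_in_carrier[OF Z] g)
  qed
qed

context
  fixes X :: "('a, 'm) gorder_scheme" and Y :: "('b, 'n) gorder_scheme"
  assumes X: "complete_lattice X" and Y: "complete_lattice Y"
begin

interpretation P: sup_lattice_congruence "powerset_lattice (carrier X \<times> carrier Y)" "tensor_congruence X Y"
  by (rule tensor_sup_lattice_congruence[OF X Y])

lemma pure_tensor_cls: "pure_tensor X Y x y = P.cls {(x, y)}"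
  by (simp add: pure_tensor_def P.cls_def)

text \<open>A set is the union of its singletons and \<open>cls\<close> preserves joins. This is the
  source of the fact that pure tensors generate.\<close>

lemma tensor_cls_eq_sup:
  assumes "S \<subseteq> carrier X \<times> carrier Y"
  shows "P.cls S = \<Squnion>\<^bsub>tensor X Y\<^esub>((\<lambda>(x, y). pure_tensor X Y x y) ` S)"
proof -
  let ?A = "(\<lambda>p. {p}) ` S"
  have A: "?A \<subseteq> Pow (carrier X \<times> carrier Y)" using assms by auto
  have "S = \<Union>?A" by auto
  then have "P.cls S = P.cls (\<Squnion>\<^bsub>powerset_lattice (carrier X \<times> carrier Y)\<^esub>?A)"
    using powerset_sup[OF A] by simp
  also have "\<dots> = \<Squnion>\<^bsub>tensor X Y\<^esub>(P.cls ` ?A)"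
    unfolding tensor_def using A
    by (intro sup_morphism_sup[OF P.cls_sup_morphism]) (simp add: powerset_lattice_def)
  also have "P.cls ` ?A = (\<lambda>(x, y). pure_tensor X Y x y) ` S"
    by (auto simp: image_image pure_tensor_cls)
  finally show ?thesis .
qed

lemma pure_tensor_carrier:
  "\<lbrakk>x \<in> carrier X; y \<in> carrier Y\<rbrakk> \<Longrightarrow> pure_tensor X Y x y \<in> carrier (tensor X Y)"
  unfolding pure_tensor_cls tensor_def by (rule P.cls_carrier) (simp add: powerset_lattice_def)

text \<open>The two kinds of generators of \<open>tensor_congruence\<close> are exactly the two
  preservation laws, empty joins included.\<close>

lemma pure_tensor_bimorphism: "bimorphism X Y (tensor X Y) (pure_tensor X Y)"
proof -
  let ?P = "powerset_lattice (carrier X \<times> carrier Y)"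
  have sup1: "pure_tensor X Y (\<Squnion>\<^bsub>X\<^esub>A) y = \<Squnion>\<^bsub>tensor X Y\<^esub>((\<lambda>x. pure_tensor X Y x y) ` A)"
    if "A \<subseteq> carrier X" "y \<in> carrier Y" for A y
  proof -
    have "({(\<Squnion>\<^bsub>X\<^esub>A, y)}, A \<times> {y}) \<in> tensor_congruence X Y"
      unfolding tensor_congruence_def using that by (intro generated_congruence_contains) blast
    then have "P.cls {(\<Squnion>\<^bsub>X\<^esub>A, y)} = P.cls (A \<times> {y})"
      using P.E_carrier by (subst P.cls_eq_iff) blast+
    also have "\<dots> = \<Squnion>\<^bsub>tensor X Y\<^esub>((\<lambda>(x, y). pure_tensor X Y x y) ` (A \<times> {y}))"
      using that by (intro tensor_cls_eq_sup) auto
    also have "(\<lambda>(x, y). pure_tensor X Y x y) ` (A \<times> {y}) = (\<lambda>x. pure_tensor X Y x y) ` A"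
      by auto
    finally show ?thesis by (simp add: pure_tensor_cls)
  qed
  have sup2: "pure_tensor X Y x (\<Squnion>\<^bsub>Y\<^esub>B) = \<Squnion>\<^bsub>tensor X Y\<^esub>(pure_tensor X Y x ` B)"
    if "x \<in> carrier X" "B \<subseteq> carrier Y" for x B
  proof -
    have "({(x, \<Squnion>\<^bsub>Y\<^esub>B)}, {x} \<times> B) \<in> tensor_congruence X Y"
      unfolding tensor_congruence_def using that by (intro generated_congruence_contains) blast
    then have "P.cls {(x, \<Squnion>\<^bsub>Y\<^esub>B)} = P.cls ({x} \<times> B)"
      using P.E_carrier by (subst P.cls_eq_iff) blast+
    also have "\<dots> = \<Squnion>\<^bsub>tensor X Y\<^esub>((\<lambda>(x, y). pure_tensor X Y x y) ` ({x} \<times> B))"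
      using that by (intro tensor_cls_eq_sup) auto
    also have "(\<lambda>(x, y). pure_tensor X Y x y) ` ({x} \<times> B) = pure_tensor X Y x ` B"
      by auto
    finally show ?thesis by (simp add: pure_tensor_cls)
  qed
  show ?thesis
    unfolding bimorphism_def using sup1 sup2 by (auto intro!: sup_morphismI pure_tensor_carrier)
qed

lemma tensor_carrier_generated:
  assumes "c \<in> carrier (tensor X Y)"
  obtains S where "S \<subseteq> carrier X \<times> carrier Y"
    "c = \<Squnion>\<^bsub>tensor X Y\<^esub>((\<lambda>(x, y). pure_tensor X Y x y) ` S)"
proof -
  from assms obtain S where "c = P.cls S" "S \<in> carrier (powerset_lattice (carrier X \<times> carrier Y))"
    unfolding tensor_def P.carrier_quotient by blast
  then show ?thesis using that tensor_cls_eq_sup by (auto simp: powerset_lattice_def)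
qed

text \<open>The free extension of g to subsets takes equal values on the two sides of each generator
  because g preserves joins in each variable, so it descends to the quotient.\<close>

lemma tensor_lift:
  assumes Z: "complete_lattice Z" and g: "bimorphism X Y Z g"
  obtains f where "sup_morphism (tensor X Y) Z f"
    "\<And>x y. \<lbrakk>x \<in> carrier X; y \<in> carrier Y\<rbrakk> \<Longrightarrow> f (pure_tensor X Y x y) = g x y"
proof -
  let ?P = "powerset_lattice (carrier X \<times> carrier Y)"
  let ?h = "\<lambda>S. \<Squnion>\<^bsub>Z\<^esub>((\<lambda>(x, y). g x y) ` S)"
  have gc: "g x y \<in> carrier Z" if "x \<in> carrier X" "y \<in> carrier Y" for x y
    using bimorphism_closed[OF g that] .
  have h: "sup_morphism ?P Z ?h" by (rule sup_morphism_from_powerset[OF Z]) (auto simp: gc)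
  have respects: "?h a = ?h b" if "(a, b) \<in> tensor_congruence X Y" for a b
  proof (rule generated_congruence_respects[OF _ h tensor_generators_carrier[OF X Y] _
        that[unfolded tensor_congruence_def]])
    show "complete_lattice ?P" by (rule powerset_complete_lattice)
    fix a b
    assume "(a, b) \<in> {({(\<Squnion>\<^bsub>X\<^esub>A, y)}, A \<times> {y}) | A y. A \<subseteq> carrier X \<and> y \<in> carrier Y} \<union>
        {({(x, \<Squnion>\<^bsub>Y\<^esub>B)}, {x} \<times> B) | x B. x \<in> carrier X \<and> B \<subseteq> carrier Y}"
    then show "?h a = ?h b"
    proof (elim UnE CollectE exE conjE Pair_inject)
      fix A y assume 1: "a = {(\<Squnion>\<^bsub>X\<^esub>A, y)}" "b = A \<times> {y}" "A \<subseteq> carrier X" "y \<in> carrier Y"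
      have "(\<lambda>(x, y). g x y) ` (A \<times> {y}) = (\<lambda>x. g x y) ` A" by auto
      moreover have "g (\<Squnion>\<^bsub>X\<^esub>A) y = \<Squnion>\<^bsub>Z\<^esub>((\<lambda>x. g x y) ` A)"
        using sup_morphism_sup[OF bimorphism_left[OF g 1(4)] 1(3)] .
      ultimately show "?h a = ?h b" using 1 sup_singleton[OF Z gc[OF sup_in_carrier[OF X 1(3)] 1(4)]] by simp
    next
      fix x B assume 2: "a = {(x, \<Squnion>\<^bsub>Y\<^esub>B)}" "b = {x} \<times> B" "x \<in> carrier X" "B \<subseteq> carrier Y"
      have "(\<lambda>(x, y). g x y) ` ({x} \<times> B) = g x ` B" by auto
      moreover have "g x (\<Squnion>\<^bsub>Y\<^esub>B) = \<Squnion>\<^bsub>Z\<^esub>(g x ` B)"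
        using sup_morphism_sup[OF bimorphism_right[OF g 2(3)] 2(4)] .
      ultimately show "?h a = ?h b" using 2 sup_singleton[OF Z gc[OF 2(3) sup_in_carrier[OF Y 2(4)]]] by simp
    qed
  qed
  obtain f where f: "sup_morphism P.XE Z f" "\<And>a. a \<in> carrier ?P \<Longrightarrow> f (P.cls a) = ?h a"
    using P.quotient_lift[OF h respects] by blast
  show ?thesis
  proof (rule that)
    show "sup_morphism (tensor X Y) Z f" using f(1) by (simp add: tensor_def)
    show "f (pure_tensor X Y x y) = g x y" if "x \<in> carrier X" "y \<in> carrier Y" for x y
      using f(2)[of "{(x, y)}"] that gc[OF that]
      by (simp add: pure_tensor_cls powerset_lattice_def sup_singleton[OF Z])
  qed
qed

end


section \<open>The tensor product over T\<close>

context triad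
begin

abbreviation "T \<equiv> trT D"
abbreviation "L \<equiv> trL D"
abbreviation "R \<equiv> trR D"
abbreviation "Q0L \<equiv> Q0_lattice D"
abbreviation pure (infixl \<open>\<otimes>\<close> 70) where "pure \<equiv> Q0_pure D"

lemma L_lattice: "complete_lattice L"
  using module_L by (simp add: left_module_def)

lemma R_lattice: "complete_lattice R"
  using module_R by (simp add: right_module_def)

lemma actL_bimorphism: "bimorphism T L L (actL D)"
  using module_L by (simp add: left_module_def)

lemma actR_bimorphism: "bimorphism R T R (actR D)"
  using module_R by (simp add: right_module_def)

lemma actL_closed: "\<lbrakk>t \<in> carrier T; l \<in> carrier L\<rbrakk> \<Longrightarrow> actL D t l \<in> carrier L"
  using bimorphism_closed[OF actL_bimorphism] .

lemma actR_closed: "\<lbrakk>r \<in> carrier R; t \<in> carrier T\<rbrakk> \<Longrightarrow> actR D r t \<in> carrier R"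
  using bimorphism_closed[OF actR_bimorphism] .

lemma pairing_closed: "\<lbrakk>l \<in> carrier L; r \<in> carrier R\<rbrakk> \<Longrightarrow> pairing D l r \<in> carrier T"
  using bimorphism_closed[OF pairing_bimorphism] .

lemma actL_assoc:
  "\<lbrakk>t \<in> carrier T; t' \<in> carrier T; l \<in> carrier L\<rbrakk>
    \<Longrightarrow> actL D (t \<cdot>\<^bsub>T\<^esub> t') l = actL D t (actL D t' l)"
  using module_L by (simp add: left_module_def)

lemma actR_assoc:
  "\<lbrakk>t \<in> carrier T; t' \<in> carrier T; r \<in> carrier R\<rbrakk>
    \<Longrightarrow> actR D r (t \<cdot>\<^bsub>T\<^esub> t') = actR D (actR D r t) t'"
  using module_R by (simp add: right_module_def)

text \<open>These are the maps that the tensor product over T represents: join-preserving in each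
  variable and letting scalars cross from R to L.\<close>

definition balanced :: "('x, 'n) gorder_scheme \<Rightarrow> ('r \<Rightarrow> 'l \<Rightarrow> 'x) \<Rightarrow> bool" where
  "balanced X g \<longleftrightarrow> bimorphism R L X g \<and>
     (\<forall>r\<in>carrier R. \<forall>t\<in>carrier T. \<forall>l\<in>carrier L. g (actR D r t) l = g r (actL D t l))"

lemma tensor_lattice: "complete_lattice (tensor R L)"
  by (rule tensor_complete_lattice[OF R_lattice L_lattice])

lemma Q0_generators_carrier:
  "{(pure_tensor R L (actR D r t) l, pure_tensor R L r (actL D t l)) | r t l.
      r \<in> carrier R \<and> t \<in> carrier T \<and> l \<in> carrier L} \<subseteq> carrier (tensor R L) \<times> carrier (tensor R L)"
  by (auto intro!: pure_tensor_carrier R_lattice L_lattice actR_closed actL_closed)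

text \<open>The second of two successive quotients: the classes that form the plain tensor product
  are divided again, by the relation moving scalars across. All quotient lemmas become available for
  it.\<close>

sublocale Q0_quotient: sup_lattice_congruence "tensor R L" "Q0_congruence D"
  unfolding Q0_congruence_def
  by (intro sup_lattice_congruence.intro sup_lattice_congruence_axioms.intro sup_congruence_generated
      tensor_lattice Q0_generators_carrier)

lemma Q0_lattice_complete: "complete_lattice Q0L"
  unfolding Q0_lattice_def by (rule Q0_quotient.quotient_complete_lattice)

lemma pure_eq_cls: "r \<otimes> l = Q0_quotient.cls (pure_tensor R L r l)"
  by (simp add: Q0_pure_def Q0_quotient.cls_def)

lemma pure_bimorphism: "bimorphism R L Q0L pure"
  unfolding pure_eq_cls[abs_def] Q0_lattice_def
  by (rule bimorphism_comp[OF pure_tensor_bimorphism Q0_quotient.cls_sup_morphism])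
    (rule R_lattice L_lattice)+

lemma pure_closed: "\<lbrakk>r \<in> carrier R; l \<in> carrier L\<rbrakk> \<Longrightarrow> r \<otimes> l \<in> carrier Q0L"
  using bimorphism_closed[OF pure_bimorphism] .

lemma pure_balanced:
  "\<lbrakk>r \<in> carrier R; t \<in> carrier T; l \<in> carrier L\<rbrakk> \<Longrightarrow> actR D r t \<otimes> l = r \<otimes> actL D t l"
  unfolding pure_eq_cls
  by (subst Q0_quotient.cls_eq_iff)
    (auto simp: Q0_congruence_def intro!: pure_tensor_carrier R_lattice L_lattice actR_closed
      actL_closed generated_congruence_contains)

lemma Q0_carrier_generated:
  assumes "c \<in> carrier Q0L"
  obtains S where "S \<subseteq> carrier R \<times> carrier L" "c = \<Squnion>\<^bsub>Q0L\<^esub>((\<lambda>(r, l). r \<otimes> l) ` S)"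
proof -
  from assms obtain b where b: "c = Q0_quotient.cls b" "b \<in> carrier (tensor R L)"
    unfolding Q0_lattice_def Q0_quotient.carrier_quotient by blast
  obtain S where S: "S \<subseteq> carrier R \<times> carrier L" "b = \<Squnion>\<^bsub>tensor R L\<^esub>((\<lambda>(r, l). pure_tensor R L r l) ` S)"
    using tensor_carrier_generated[OF R_lattice L_lattice b(2)] .
  have "(\<lambda>(r, l). pure_tensor R L r l) ` S \<subseteq> carrier (tensor R L)"
    using S(1) by (auto intro!: pure_tensor_carrier R_lattice L_lattice)
  then have "c = \<Squnion>\<^bsub>Q0L\<^esub>(Q0_quotient.cls ` ((\<lambda>(r, l). pure_tensor R L r l) ` S))"
    unfolding b(1) S(2) Q0_lattice_def by (rule sup_morphism_sup[OF Q0_quotient.cls_sup_morphism])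
  also have "Q0_quotient.cls ` ((\<lambda>(r, l). pure_tensor R L r l) ` S) = (\<lambda>(r, l). r \<otimes> l) ` S"
    by (auto simp: image_image pure_eq_cls intro!: image_cong)
  finally show ?thesis using that S(1) by blast
qed

text \<open>Both maps send a join of pure tensors to the join of one and the same set of values, so
  X may be any order. Nearly every equation on \<open>Q0\<close> below is an instance.\<close>

lemma Q0_morphism_eqI:
  assumes f: "sup_morphism Q0L X f" and g: "sup_morphism Q0L X g"
    and "\<And>r l. \<lbrakk>r \<in> carrier R; l \<in> carrier L\<rbrakk> \<Longrightarrow> f (r \<otimes> l) = g (r \<otimes> l)"
    and c: "c \<in> carrier Q0L"
  shows "f c = g c"
proof -
  obtain S where S: "S \<subseteq> carrier R \<times> carrier L" "c = \<Squnion>\<^bsub>Q0L\<^esub>((\<lambda>(r, l). r \<otimes> l) ` S)"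
    using Q0_carrier_generated[OF c] .
  have sub: "(\<lambda>(r, l). r \<otimes> l) ` S \<subseteq> carrier Q0L" using S(1) pure_closed by auto
  have "f ` (\<lambda>(r, l). r \<otimes> l) ` S = g ` (\<lambda>(r, l). r \<otimes> l) ` S"
    unfolding image_image using S(1) assms(3) by (intro image_cong) auto
  then show ?thesis
    unfolding S(2) using sup_morphism_sup[OF f sub] sup_morphism_sup[OF g sub] by simp
qed

lemma Q0_lift_exists:
  assumes X: "complete_lattice X" and g: "balanced X g"
  obtains f where "f \<in> extensional (carrier Q0L)" "sup_morphism Q0L X f"
    "\<And>r l. \<lbrakk>r \<in> carrier R; l \<in> carrier L\<rbrakk> \<Longrightarrow> f (r \<otimes> l) = g r l"
proof -
  have gb: "bimorphism R L X g" using g by (simp add: balanced_def)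
  obtain h where h: "sup_morphism (tensor R L) X h"
    "\<And>r l. \<lbrakk>r \<in> carrier R; l \<in> carrier L\<rbrakk> \<Longrightarrow> h (pure_tensor R L r l) = g r l"
    using tensor_lift[OF R_lattice L_lattice X gb] by blast
  have "h a = h b" if "(a, b) \<in> Q0_congruence D" for a b
    by (rule generated_congruence_respects[OF tensor_lattice h(1) Q0_generators_carrier _
          that[unfolded Q0_congruence_def]])
      (use g in \<open>auto simp: h(2) actL_closed actR_closed balanced_def\<close>)
  then obtain f where f: "sup_morphism Q0_quotient.XE X f"
    "\<And>a. a \<in> carrier (tensor R L) \<Longrightarrow> f (Q0_quotient.cls a) = h a"
    using Q0_quotient.quotient_lift[OF h(1)] by blast
  show ?thesis
  proof (rule that)
    \<comment> \<open>Truncating f outside the carrier makes it unique as a HOL function, as the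
      definite description in \<open>Q0_lift\<close> demands.\<close>
    show "restrict f (carrier Q0L) \<in> extensional (carrier Q0L)" by simp
    have "sup_morphism Q0L X f" using f(1) by (simp add: Q0_lattice_def)
    then show "sup_morphism Q0L X (restrict f (carrier Q0L))"
      by (subst sup_morphism_cong[OF Q0_lattice_complete, of _ f]) auto
    show "restrict f (carrier Q0L) (r \<otimes> l) = g r l" if "r \<in> carrier R" "l \<in> carrier L" for r l
      using that pure_closed[OF that] pure_tensor_carrier[OF R_lattice L_lattice that]
      by (simp add: pure_eq_cls f(2) h(2))
  qed
qed

lemma Q0_lift_unique:
  assumes f: "f \<in> extensional (carrier Q0L)" "sup_morphism Q0L X f"
    "\<And>r l. \<lbrakk>r \<in> carrier R; l \<in> carrier L\<rbrakk> \<Longrightarrow> f (r \<otimes> l) = g r l"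
  shows "Q0_lift D X g = f"
  unfolding Q0_lift_def
proof (rule the_equality)
  fix f' assume f': "f' \<in> extensional (carrier Q0L) \<and> sup_morphism Q0L X f' \<and>
    (\<forall>r\<in>carrier R. \<forall>l\<in>carrier L. f' (r \<otimes> l) = g r l)"
  show "f' = f"
    by (rule extensionalityI[of _ "carrier Q0L"])
      (use f f' in \<open>auto intro: Q0_morphism_eqI[of X]\<close>)
qed (use f in auto)

lemma
  assumes "complete_lattice X" "balanced X g"
  shows Q0_lift_extensional: "Q0_lift D X g \<in> extensional (carrier Q0L)"
    and Q0_lift_sup_morphism: "sup_morphism Q0L X (Q0_lift D X g)"
    and Q0_lift_pure: "\<lbrakk>r \<in> carrier R; l \<in> carrier L\<rbrakk> \<Longrightarrow> Q0_lift D X g (r \<otimes> l) = g r l"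
proof -
  obtain f where f: "f \<in> extensional (carrier Q0L)" "sup_morphism Q0L X f"
    "\<And>r l. \<lbrakk>r \<in> carrier R; l \<in> carrier L\<rbrakk> \<Longrightarrow> f (r \<otimes> l) = g r l"
    using Q0_lift_exists[OF assms] by blast
  note eq = Q0_lift_unique[OF f]
  show "Q0_lift D X g \<in> extensional (carrier Q0L)" using f(1) by (simp only: eq)
  show "sup_morphism Q0L X (Q0_lift D X g)" using f(2) by (simp only: eq)
  show "Q0_lift D X g (r \<otimes> l) = g r l" if "r \<in> carrier R" "l \<in> carrier L"
    using f(3)[OF that] by (simp only: eq)
qed

text \<open>A known morphism with the values g already is the lift of g, so the balance of g is
  inherited instead of proved. This is how the two nested lifts in \<open>Q0_mult\<close> are
  evaluated.\<close>

lemma Q0_lift_of_morphism: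
  assumes f: "sup_morphism Q0L X f" and c: "c \<in> carrier Q0L"
    and g: "\<And>r l. \<lbrakk>r \<in> carrier R; l \<in> carrier L\<rbrakk> \<Longrightarrow> g r l = f (r \<otimes> l)"
  shows "Q0_lift D X g c = f c"
proof -
  have "Q0_lift D X g = restrict f (carrier Q0L)"
  proof (rule Q0_lift_unique)
    show "sup_morphism Q0L X (restrict f (carrier Q0L))"
      by (subst sup_morphism_cong[OF Q0_lattice_complete, of _ f]) (use f in auto)
  qed (use g in \<open>auto simp: pure_closed\<close>)
  then show ?thesis using c by simp
qed

text \<open>For a fixed family A in S, both sides of the join law in the first variable are
  morphisms in c, the right side as a pointwise join of morphisms. So the law has to be checked at
  pure tensors only.\<close>

lemma bimorphism_Q0I:
  assumes S: "complete_lattice S" and X: "complete_lattice X"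
    and right: "\<And>s. s \<in> carrier S \<Longrightarrow> sup_morphism Q0L X (b s)"
    and left: "\<And>r l. \<lbrakk>r \<in> carrier R; l \<in> carrier L\<rbrakk> \<Longrightarrow> sup_morphism S X (\<lambda>s. b s (r \<otimes> l))"
  shows "bimorphism S Q0L X b"
  unfolding bimorphism_def
proof (intro conjI ballI)
  fix c assume c: "c \<in> carrier Q0L"
  show "sup_morphism S X (\<lambda>s. b s c)"
  proof (rule sup_morphismI)
    show "b s c \<in> carrier X" if "s \<in> carrier S" for s
      using sup_morphism_closed[OF right[OF that] c] .
    fix A assume A: "A \<subseteq> carrier S"
    show "b (\<Squnion>\<^bsub>S\<^esub>A) c = \<Squnion>\<^bsub>X\<^esub>((\<lambda>s. b s c) ` A)"
    proof (rule Q0_morphism_eqI[OF _ _ _ c])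
      show "sup_morphism Q0L X (b (\<Squnion>\<^bsub>S\<^esub>A))"
        using A by (intro right sup_in_carrier[OF S])
      show "sup_morphism Q0L X (\<lambda>c. \<Squnion>\<^bsub>X\<^esub>((\<lambda>s. b s c) ` A))"
        using A right by (intro sup_morphism_pointwise_sup X Q0_lattice_complete) auto
      show "b (\<Squnion>\<^bsub>S\<^esub>A) (r \<otimes> l) = \<Squnion>\<^bsub>X\<^esub>((\<lambda>s. b s (r \<otimes> l)) ` A)"
        if "r \<in> carrier R" "l \<in> carrier L" for r l
        using sup_morphism_sup[OF left[OF that] A] .
    qed
  qed
qed (rule right)

end


section \<open>The quantale of adjoint pairs\<close>

context triad
begin

abbreviation "Q1D \<equiv> Q1 D"

lemma Q1_carrierI:
  assumes "\<alpha> \<in> extensional (carrier L)" "\<beta> \<in> extensional (carrier R)"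
    "left_module_morphism T L (actL D) L (actL D) \<alpha>"
    "right_module_morphism T R (actR D) R (actR D) \<beta>"
    "\<And>l r. \<lbrakk>l \<in> carrier L; r \<in> carrier R\<rbrakk> \<Longrightarrow> pairing D (\<alpha> l) r = pairing D l (\<beta> r)"
  shows "(\<alpha>, \<beta>) \<in> carrier Q1D"
  using assms
  by (auto simp: Q1_def PiE_def left_module_morphism_def right_module_morphism_def sup_morphism_def)

text \<open>Elements of \<open>Q1\<close> must be extensional, but natural formulas are not.
  Truncation changes none of the laws, since the maps and actions never leave the carriers.\<close>

lemma Q1_restrict_carrierI:
  assumes \<alpha>: "sup_morphism L L \<alpha>"
    "\<And>t l. \<lbrakk>t \<in> carrier T; l \<in> carrier L\<rbrakk> \<Longrightarrow> \<alpha> (actL D t l) = actL D t (\<alpha> l)"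
    and \<beta>: "sup_morphism R R \<beta>"
    "\<And>t r. \<lbrakk>t \<in> carrier T; r \<in> carrier R\<rbrakk> \<Longrightarrow> \<beta> (actR D r t) = actR D (\<beta> r) t"
    and adj: "\<And>l r. \<lbrakk>l \<in> carrier L; r \<in> carrier R\<rbrakk> \<Longrightarrow> pairing D (\<alpha> l) r = pairing D l (\<beta> r)"
  shows "(restrict \<alpha> (carrier L), restrict \<beta> (carrier R)) \<in> carrier Q1D"
proof (rule Q1_carrierI)
  have "sup_morphism L L (restrict \<alpha> (carrier L))"
    by (subst sup_morphism_cong[OF L_lattice, of _ \<alpha>]) (simp_all add: \<alpha>(1))
  then show "left_module_morphism T L (actL D) L (actL D) (restrict \<alpha> (carrier L))"
    using \<alpha>(2) by (simp add: left_module_morphism_def actL_closed)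
  have "sup_morphism R R (restrict \<beta> (carrier R))"
    by (subst sup_morphism_cong[OF R_lattice, of _ \<beta>]) (simp_all add: \<beta>(1))
  then show "right_module_morphism T R (actR D) R (actR D) (restrict \<beta> (carrier R))"
    using \<beta>(2) by (simp add: right_module_morphism_def actR_closed)
qed (use adj in auto)

lemma
  assumes "q \<in> carrier Q1D"
  shows Q1_fst_sup_morphism: "sup_morphism L L (fst q)"
    and Q1_snd_sup_morphism: "sup_morphism R R (snd q)"
    and Q1_fst_extensional: "fst q \<in> extensional (carrier L)"
    and Q1_snd_extensional: "snd q \<in> extensional (carrier R)"
    and Q1_fst_actL: "\<lbrakk>t \<in> carrier T; l \<in> carrier L\<rbrakk> \<Longrightarrow> fst q (actL D t l) = actL D t (fst q l)"
    and Q1_snd_actR: "\<lbrakk>t \<in> carrier T; r \<in> carrier R\<rbrakk> \<Longrightarrow> snd q (actR D r t) = actR D (snd q r) t"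
    and Q1_adjoint: "\<lbrakk>l \<in> carrier L; r \<in> carrier R\<rbrakk> \<Longrightarrow> pairing D (fst q l) r = pairing D l (snd q r)"
    and Q1_fst_closed: "l \<in> carrier L \<Longrightarrow> fst q l \<in> carrier L"
    and Q1_snd_closed: "r \<in> carrier R \<Longrightarrow> snd q r \<in> carrier R"
  using assms
  by (auto simp: Q1_def PiE_def left_module_morphism_def right_module_morphism_def)

lemma Q1_eqI:
  assumes q: "q \<in> carrier Q1D" and q': "q' \<in> carrier Q1D"
    and "\<And>l. l \<in> carrier L \<Longrightarrow> fst q l = fst q' l" "\<And>r. r \<in> carrier R \<Longrightarrow> snd q r = snd q' r"
  shows "q = q'"
proof (rule prod_eqI)
  show "fst q = fst q'"
    using Q1_fst_extensional[OF q] Q1_fst_extensional[OF q'] assms(3) by (rule extensionalityI)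
  show "snd q = snd q'"
    using Q1_snd_extensional[OF q] Q1_snd_extensional[OF q'] assms(4) by (rule extensionalityI)
qed

lemma Q1_le_iff:
  "q \<sqsubseteq>\<^bsub>Q1D\<^esub> q' \<longleftrightarrow>
     (\<forall>l\<in>carrier L. fst q l \<sqsubseteq>\<^bsub>L\<^esub> fst q' l) \<and> (\<forall>r\<in>carrier R. snd q r \<sqsubseteq>\<^bsub>R\<^esub> snd q' r)"
  by (auto simp: Q1_def split: prod.splits)

definition Q1_pointwise_sup :: "('l, 'r) q1 set \<Rightarrow> ('l, 'r) q1" where
  "Q1_pointwise_sup A =
     (\<lambda>l\<in>carrier L. \<Squnion>\<^bsub>L\<^esub>((\<lambda>q. fst q l) ` A), \<lambda>r\<in>carrier R. \<Squnion>\<^bsub>R\<^esub>((\<lambda>q. snd q r) ` A))"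

text \<open>Linearity and adjointness are equations between expressions that preserve joins in
  \<open>fst q\<close> and \<open>snd q\<close>, so they hold for the pointwise join because they
  hold for each q in A.\<close>

lemma Q1_pointwise_sup_closed:
  assumes A: "A \<subseteq> carrier Q1D"
  shows "Q1_pointwise_sup A \<in> carrier Q1D"
  unfolding Q1_pointwise_sup_def
proof (rule Q1_restrict_carrierI)
  have q: "q \<in> carrier Q1D" if "q \<in> A" for q using A that by auto
  have L: "(\<lambda>q. fst q l) ` A \<subseteq> carrier L" if "l \<in> carrier L" for l
    using q that by (auto intro: Q1_fst_closed)
  have R: "(\<lambda>q. snd q r) ` A \<subseteq> carrier R" if "r \<in> carrier R" for r
    using q that by (auto intro: Q1_snd_closed)
  show "sup_morphism L L (\<lambda>l. \<Squnion>\<^bsub>L\<^esub>((\<lambda>q. fst q l) ` A))"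
    using q by (intro sup_morphism_pointwise_sup L_lattice Q1_fst_sup_morphism)
  show "sup_morphism R R (\<lambda>r. \<Squnion>\<^bsub>R\<^esub>((\<lambda>q. snd q r) ` A))"
    using q by (intro sup_morphism_pointwise_sup R_lattice Q1_snd_sup_morphism)
  show "(\<Squnion>\<^bsub>L\<^esub>((\<lambda>q. fst q (actL D t l)) ` A)) = actL D t (\<Squnion>\<^bsub>L\<^esub>((\<lambda>q. fst q l) ` A))"
    if "t \<in> carrier T" "l \<in> carrier L" for t l
    unfolding sup_morphism_sup[OF bimorphism_right[OF actL_bimorphism that(1)] L[OF that(2)]] image_image
    using q that by (simp add: Q1_fst_actL cong: image_cong)
  show "(\<Squnion>\<^bsub>R\<^esub>((\<lambda>q. snd q (actR D r t)) ` A)) = actR D (\<Squnion>\<^bsub>R\<^esub>((\<lambda>q. snd q r) ` A)) t"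
    if "t \<in> carrier T" "r \<in> carrier R" for t r
    unfolding sup_morphism_sup[OF bimorphism_left[OF actR_bimorphism that(1)] R[OF that(2)]] image_image
    using q that by (simp add: Q1_snd_actR cong: image_cong)
  show "pairing D (\<Squnion>\<^bsub>L\<^esub>((\<lambda>q. fst q l) ` A)) r = pairing D l (\<Squnion>\<^bsub>R\<^esub>((\<lambda>q. snd q r) ` A))"
    if "l \<in> carrier L" "r \<in> carrier R" for l r
    unfolding sup_morphism_sup[OF bimorphism_left[OF pairing_bimorphism that(2)] L[OF that(1)]]
      sup_morphism_sup[OF bimorphism_right[OF pairing_bimorphism that(1)] R[OF that(2)]] image_image
    using q that by (simp add: Q1_adjoint cong: image_cong)
qed

text \<open>Only joins are computed pointwise; a pointwise meet of join-preserving maps need not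
  preserve joins, and meets come from the existence of all joins.\<close>

lemma Q1_lattice: "complete_lattice Q1D"
proof (rule complete_lattice_of_sups[where s = Q1_pointwise_sup])
  interpret L: complete_lattice L by (rule L_lattice)
  interpret R: complete_lattice R by (rule R_lattice)
  show "eq Q1D = (=)" by (simp add: Q1_def)
  show "q \<sqsubseteq>\<^bsub>Q1D\<^esub> q" if "q \<in> carrier Q1D" for q
    using that by (simp add: Q1_le_iff Q1_fst_closed Q1_snd_closed)
  show "q = q'" if "q \<in> carrier Q1D" "q' \<in> carrier Q1D" "q \<sqsubseteq>\<^bsub>Q1D\<^esub> q'" "q' \<sqsubseteq>\<^bsub>Q1D\<^esub> q" for q q'
    using that
    by (intro Q1_eqI L.le_antisym R.le_antisym) (simp_all add: Q1_le_iff Q1_fst_closed Q1_snd_closed)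
  show "q \<sqsubseteq>\<^bsub>Q1D\<^esub> q''" if q: "q \<in> carrier Q1D" "q' \<in> carrier Q1D" "q'' \<in> carrier Q1D"
    and le: "q \<sqsubseteq>\<^bsub>Q1D\<^esub> q'" "q' \<sqsubseteq>\<^bsub>Q1D\<^esub> q''" for q q' q''
    unfolding Q1_le_iff
  proof (intro conjI ballI)
    show "fst q l \<sqsubseteq>\<^bsub>L\<^esub> fst q'' l" if "l \<in> carrier L" for l
      by (rule L.le_trans[of _ "fst q' l"]) (use le q that in \<open>simp_all add: Q1_le_iff Q1_fst_closed\<close>)
    show "snd q r \<sqsubseteq>\<^bsub>R\<^esub> snd q'' r" if "r \<in> carrier R" for r
      by (rule R.le_trans[of _ "snd q' r"]) (use le q that in \<open>simp_all add: Q1_le_iff Q1_snd_closed\<close>)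
  qed
  show "Q1_pointwise_sup A \<in> carrier Q1D" if "A \<subseteq> carrier Q1D" for A
    by (rule Q1_pointwise_sup_closed[OF that])
  fix A assume A: "A \<subseteq> carrier Q1D"
  have L: "(\<lambda>q. fst q l) ` A \<subseteq> carrier L" if "l \<in> carrier L" for l
    using that A by (auto intro: Q1_fst_closed)
  have R: "(\<lambda>q. snd q r) ` A \<subseteq> carrier R" if "r \<in> carrier R" for r
    using that A by (auto intro: Q1_snd_closed)
  show "q \<sqsubseteq>\<^bsub>Q1D\<^esub> Q1_pointwise_sup A" if "q \<in> A" for q
    using L.sup_upper[OF L imageI[OF that]] R.sup_upper[OF R imageI[OF that]]
    by (simp add: Q1_le_iff Q1_pointwise_sup_def)
  show "Q1_pointwise_sup A \<sqsubseteq>\<^bsub>Q1D\<^esub> z"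
    if "z \<in> carrier Q1D" "\<And>q. q \<in> A \<Longrightarrow> q \<sqsubseteq>\<^bsub>Q1D\<^esub> z" for z
    using that
    by (simp add: Q1_le_iff Q1_pointwise_sup_def sup_le_iff[OF L_lattice L] sup_le_iff[OF R_lattice R]
        Q1_fst_closed Q1_snd_closed)
qed

lemma Q1_sup_eq:
  assumes A: "A \<subseteq> carrier Q1D"
  shows "(\<Squnion>\<^bsub>Q1D\<^esub>A) = Q1_pointwise_sup A"
proof (rule sup_eqI[OF Q1_lattice A Q1_pointwise_sup_closed[OF A]])
  fix z assume z: "z \<in> carrier Q1D"
  have "(\<lambda>q. fst q l) ` A \<subseteq> carrier L" if "l \<in> carrier L" for l
    using A that by (auto intro: Q1_fst_closed)
  moreover have "(\<lambda>q. snd q r) ` A \<subseteq> carrier R" if "r \<in> carrier R" for r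
    using A that by (auto intro: Q1_snd_closed)
  ultimately show "Q1_pointwise_sup A \<sqsubseteq>\<^bsub>Q1D\<^esub> z \<longleftrightarrow> (\<forall>q\<in>A. q \<sqsubseteq>\<^bsub>Q1D\<^esub> z)"
    using z by (auto simp: Q1_le_iff Q1_pointwise_sup_def sup_le_iff[OF L_lattice]
        sup_le_iff[OF R_lattice] Q1_fst_closed Q1_snd_closed)
qed

lemma Q1_eval_fst: "l \<in> carrier L \<Longrightarrow> sup_morphism Q1D L (\<lambda>q. fst q l)"
  by (rule sup_morphismI) (simp_all add: Q1_fst_closed Q1_sup_eq Q1_pointwise_sup_def)

lemma Q1_eval_snd: "r \<in> carrier R \<Longrightarrow> sup_morphism Q1D R (\<lambda>q. snd q r)"
  by (rule sup_morphismI) (simp_all add: Q1_snd_closed Q1_sup_eq Q1_pointwise_sup_def)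

text \<open>The evaluations at elements of L and R preserve joins and jointly separate the elements
  of \<open>Q1\<close>, so join preservation may be tested after each of them.\<close>

lemma Q1_sup_morphismI:
  assumes S: "complete_lattice S" and f: "\<And>s. s \<in> carrier S \<Longrightarrow> f s \<in> carrier Q1D"
    and fL: "\<And>l. l \<in> carrier L \<Longrightarrow> sup_morphism S L (\<lambda>s. fst (f s) l)"
    and fR: "\<And>r. r \<in> carrier R \<Longrightarrow> sup_morphism S R (\<lambda>s. snd (f s) r)"
  shows "sup_morphism S Q1D f"
proof (rule sup_morphismI)
  fix A assume A: "A \<subseteq> carrier S"
  then have fA: "f ` A \<subseteq> carrier Q1D" using f by auto
  show "f (\<Squnion>\<^bsub>S\<^esub>A) = \<Squnion>\<^bsub>Q1D\<^esub>(f ` A)"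
  proof (rule Q1_eqI)
    show "f (\<Squnion>\<^bsub>S\<^esub>A) \<in> carrier Q1D" using f sup_in_carrier[OF S A] .
    show "(\<Squnion>\<^bsub>Q1D\<^esub>(f ` A)) \<in> carrier Q1D" using sup_in_carrier[OF Q1_lattice fA] .
    show "fst (f (\<Squnion>\<^bsub>S\<^esub>A)) l = fst (\<Squnion>\<^bsub>Q1D\<^esub>(f ` A)) l" if "l \<in> carrier L" for l
      using sup_morphism_sup[OF fL[OF that] A] sup_morphism_sup[OF Q1_eval_fst[OF that] fA]
      by (simp add: image_image)
    show "snd (f (\<Squnion>\<^bsub>S\<^esub>A)) r = snd (\<Squnion>\<^bsub>Q1D\<^esub>(f ` A)) r" if "r \<in> carrier R" for r
      using sup_morphism_sup[OF fR[OF that] A] sup_morphism_sup[OF Q1_eval_snd[OF that] fA]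
      by (simp add: image_image)
  qed
qed (rule f)

text \<open>On L the order of composition is reversed because \<open>Q1\<close> acts there from the
  right: l(qq') = (lq)q'.\<close>

lemma
  shows Q1_mult_fst: "l \<in> carrier L \<Longrightarrow> fst (q \<cdot>\<^bsub>Q1D\<^esub> q') l = fst q' (fst q l)"
    and Q1_mult_snd: "r \<in> carrier R \<Longrightarrow> snd (q \<cdot>\<^bsub>Q1D\<^esub> q') r = snd q (snd q' r)"
  by (simp_all add: Q1_def compose_def split: prod.splits)

lemma Q1_mult_closed:
  assumes q: "q \<in> carrier Q1D" and q': "q' \<in> carrier Q1D"
  shows "q \<cdot>\<^bsub>Q1D\<^esub> q' \<in> carrier Q1D"
proof -
  have "q \<cdot>\<^bsub>Q1D\<^esub> q' = (restrict (\<lambda>l. fst q' (fst q l)) (carrier L), restrict (\<lambda>r. snd q (snd q' r)) (carrier R))"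
    by (simp add: Q1_def compose_def split: prod.splits)
  also have "\<dots> \<in> carrier Q1D"
  proof (rule Q1_restrict_carrierI)
    show "sup_morphism L L (\<lambda>l. fst q' (fst q l))"
      by (rule sup_morphism_comp[OF Q1_fst_sup_morphism[OF q] Q1_fst_sup_morphism[OF q']])
    show "sup_morphism R R (\<lambda>r. snd q (snd q' r))"
      by (rule sup_morphism_comp[OF Q1_snd_sup_morphism[OF q'] Q1_snd_sup_morphism[OF q]])
  qed (use q q' in \<open>simp_all add: Q1_fst_actL Q1_snd_actR Q1_fst_closed Q1_snd_closed Q1_adjoint\<close>)
  finally show ?thesis .
qed

lemma Q1_mult_bimorphism: "bimorphism Q1D Q1D Q1D (qmult Q1D)"
  unfolding bimorphism_def
proof (intro conjI ballI)
  fix q assume q: "q \<in> carrier Q1D"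
  show "sup_morphism Q1D Q1D (qmult Q1D q)"
  proof (rule Q1_sup_morphismI[OF Q1_lattice])
    show "sup_morphism Q1D L (\<lambda>q'. fst (q \<cdot>\<^bsub>Q1D\<^esub> q') l)" if "l \<in> carrier L" for l
      using that q by (simp add: Q1_mult_fst Q1_eval_fst Q1_fst_closed)
    show "sup_morphism Q1D R (\<lambda>q'. snd (q \<cdot>\<^bsub>Q1D\<^esub> q') r)" if "r \<in> carrier R" for r
      using that q by (simp add: Q1_mult_snd sup_morphism_comp[OF Q1_eval_snd Q1_snd_sup_morphism])
  qed (rule Q1_mult_closed[OF q])
  show "sup_morphism Q1D Q1D (\<lambda>q'. q' \<cdot>\<^bsub>Q1D\<^esub> q)"
  proof (rule Q1_sup_morphismI[OF Q1_lattice])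
    show "sup_morphism Q1D L (\<lambda>q'. fst (q' \<cdot>\<^bsub>Q1D\<^esub> q) l)" if "l \<in> carrier L" for l
      using that q by (simp add: Q1_mult_fst sup_morphism_comp[OF Q1_eval_fst Q1_fst_sup_morphism])
    show "sup_morphism Q1D R (\<lambda>q'. snd (q' \<cdot>\<^bsub>Q1D\<^esub> q) r)" if "r \<in> carrier R" for r
      using that q by (simp add: Q1_mult_snd Q1_eval_snd Q1_snd_closed)
  qed (rule Q1_mult_closed[OF _ q])
qed

lemma Q1_quantale: "quantale Q1D"
proof (rule quantale.intro[OF Q1_lattice], unfold_locales)
  show "a \<cdot>\<^bsub>Q1D\<^esub> b \<cdot>\<^bsub>Q1D\<^esub> c = a \<cdot>\<^bsub>Q1D\<^esub> (b \<cdot>\<^bsub>Q1D\<^esub> c)"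
    if "a \<in> carrier Q1D" "b \<in> carrier Q1D" "c \<in> carrier Q1D" for a b c
    using that
    by (intro Q1_eqI)
      (simp_all add: Q1_mult_closed Q1_mult_fst Q1_mult_snd Q1_fst_closed Q1_snd_closed)
qed (rule Q1_mult_bimorphism)

end


section \<open>The couple of a triad\<close>

context triad
begin

abbreviation "\<phi> \<equiv> coupling_phi D"

text \<open>\<open>Q0\<close> and \<open>Q0_lattice\<close> are records of different types with the
  same carrier and order. This and the following simp rules reduce statements about the former to
  the latter.\<close>

lemma Q0_carrier [simp]: "carrier (Q0 D) = carrier Q0L"
  by (simp add: Q0_def)

lemma Q0_sup [simp]: "(\<Squnion>\<^bsub>Q0 D\<^esub>A) = \<Squnion>\<^bsub>Q0L\<^esub>A"
  by (rule sup_extend_cong) (simp_all add: Q0_def)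

lemma Q0_qmult [simp]: "qmult (Q0 D) = Q0_mult D"
  by (simp add: Q0_def)

lemma Q0_sup_morphism_dom [simp]: "sup_morphism (Q0 D) X f \<longleftrightarrow> sup_morphism Q0L X f"
  by (simp add: sup_morphism_def)

lemma Q0_sup_morphism_cod [simp]: "sup_morphism X (Q0 D) f \<longleftrightarrow> sup_morphism X Q0L f"
  by (simp add: sup_morphism_def)

lemma Q0_bimorphism [simp]:
  "bimorphism (Q0 D) Y Z b \<longleftrightarrow> bimorphism Q0L Y Z b"
  "bimorphism X (Q0 D) Z b' \<longleftrightarrow> bimorphism X Q0L Z b'"
  "bimorphism X Y (Q0 D) b'' \<longleftrightarrow> bimorphism X Y Q0L b''"
  by (simp_all add: bimorphism_def)

lemma Q0_complete: "complete_lattice (Q0 D)"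
proof -
  interpret complete_lattice Q0L by (rule Q0_lattice_complete)
  show ?thesis
    by (rule complete_lattice_of_sups[where s = "\<lambda>A. \<Squnion>\<^bsub>Q0L\<^esub>A"])
      (auto simp: Q0_def intro: le_trans sup_upper sup_least dest: le_antisym)
qed

section \<open>The actions of \<open>Q1\<close> on the tensor product over T\<close>

lemma actl_balanced:
  assumes q: "q \<in> carrier Q1D"
  shows "balanced Q0L (\<lambda>r l. snd q r \<otimes> l)"
  unfolding balanced_def
proof (intro conjI ballI)
  show "bimorphism R L Q0L (\<lambda>r l. snd q r \<otimes> l)"
    by (rule bimorphism_comp_left[OF Q1_snd_sup_morphism[OF q] pure_bimorphism])
\<comment> \<open>The scalar leaves \<open>snd q\<close> by right T-linearity and then crosses the
  tensor sign.\<close>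
qed (use q in \<open>simp add: Q1_snd_actR Q1_snd_closed pure_balanced\<close>)

lemma actl_sup_morphism: "q \<in> carrier Q1D \<Longrightarrow> sup_morphism Q0L Q0L (Q0_actl D q)"
  unfolding Q0_actl_def by (intro Q0_lift_sup_morphism Q0_lattice_complete actl_balanced)

lemma actl_pure:
  "\<lbrakk>q \<in> carrier Q1D; r \<in> carrier R; l \<in> carrier L\<rbrakk> \<Longrightarrow> Q0_actl D q (r \<otimes> l) = snd q r \<otimes> l"
  unfolding Q0_actl_def by (simp add: Q0_lift_pure Q0_lattice_complete actl_balanced)

lemma actl_closed:
  "\<lbrakk>q \<in> carrier Q1D; c \<in> carrier Q0L\<rbrakk> \<Longrightarrow> Q0_actl D q c \<in> carrier Q0L"
  using sup_morphism_closed[OF actl_sup_morphism] .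

lemma actl_bimorphism: "bimorphism Q1D Q0L Q0L (Q0_actl D)"
proof (rule bimorphism_Q0I[OF Q1_lattice Q0_lattice_complete actl_sup_morphism])
  fix r l assume rl: "r \<in> carrier R" "l \<in> carrier L"
  have "sup_morphism Q1D Q0L (\<lambda>q. snd q r \<otimes> l)"
    using sup_morphism_comp[OF Q1_eval_snd[OF rl(1)] bimorphism_left[OF pure_bimorphism rl(2)]] .
  then show "sup_morphism Q1D Q0L (\<lambda>q. Q0_actl D q (r \<otimes> l))"
    by (subst sup_morphism_cong[OF Q1_lattice]) (simp_all add: actl_pure rl)
qed

lemma actr_balanced:
  assumes q: "q \<in> carrier Q1D"
  shows "balanced Q0L (\<lambda>r l. r \<otimes> fst q l)"
  unfolding balanced_def
proof (intro conjI ballI)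
  show "bimorphism R L Q0L (\<lambda>r l. r \<otimes> fst q l)"
    by (rule bimorphism_comp_right[OF Q1_fst_sup_morphism[OF q] pure_bimorphism])
qed (use q in \<open>simp add: Q1_fst_actL Q1_fst_closed pure_balanced\<close>)

lemma actr_sup_morphism: "q \<in> carrier Q1D \<Longrightarrow> sup_morphism Q0L Q0L (\<lambda>c. Q0_actr D c q)"
  unfolding Q0_actr_def by (intro Q0_lift_sup_morphism Q0_lattice_complete actr_balanced)

lemma actr_pure:
  "\<lbrakk>q \<in> carrier Q1D; r \<in> carrier R; l \<in> carrier L\<rbrakk> \<Longrightarrow> Q0_actr D (r \<otimes> l) q = r \<otimes> fst q l"
  unfolding Q0_actr_def by (simp add: Q0_lift_pure Q0_lattice_complete actr_balanced)

lemma actr_bimorphism: "bimorphism Q0L Q1D Q0L (Q0_actr D)"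
proof (subst bimorphism_flip, rule bimorphism_Q0I[OF Q1_lattice Q0_lattice_complete actr_sup_morphism])
  fix r l assume rl: "r \<in> carrier R" "l \<in> carrier L"
  have "sup_morphism Q1D Q0L (\<lambda>q. r \<otimes> fst q l)"
    using sup_morphism_comp[OF Q1_eval_fst[OF rl(2)] bimorphism_right[OF pure_bimorphism rl(1)]] .
  then show "sup_morphism Q1D Q0L (\<lambda>q. Q0_actr D (r \<otimes> l) q)"
    by (subst sup_morphism_cong[OF Q1_lattice]) (simp_all add: actr_pure rl)
qed

text \<open>The analogue of the operator |r><l| on a Hilbert space: pair with one of the two
  vectors, then multiply the other by the resulting scalar.\<close>

definition rank_one :: "'r \<Rightarrow> 'l \<Rightarrow> ('l, 'r) q1" where
  "rank_one r l = (\<lambda>l'\<in>carrier L. actL D (pairing D l' r) l, \<lambda>r'\<in>carrier R. actR D r (pairing D l r'))"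

lemma
  shows rank_one_fst: "l' \<in> carrier L \<Longrightarrow> fst (rank_one r l) l' = actL D (pairing D l' r) l"
    and rank_one_snd: "r' \<in> carrier R \<Longrightarrow> snd (rank_one r l) r' = actR D r (pairing D l r')"
  by (simp_all add: rank_one_def)

text \<open>Adjointness holds since ((l'r)l)r' and l'(r(lr')) both equal (l'r)(lr') in T.\<close>

lemma rank_one_closed:
  assumes rl: "r \<in> carrier R" "l \<in> carrier L"
  shows "rank_one r l \<in> carrier Q1D"
  unfolding rank_one_def
proof (rule Q1_restrict_carrierI)
  show "sup_morphism L L (\<lambda>l'. actL D (pairing D l' r) l)"
    using sup_morphism_comp[OF bimorphism_left[OF pairing_bimorphism rl(1)]
        bimorphism_left[OF actL_bimorphism rl(2)]] .
  show "sup_morphism R R (\<lambda>r'. actR D r (pairing D l r'))"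
    using sup_morphism_comp[OF bimorphism_right[OF pairing_bimorphism rl(2)]
        bimorphism_right[OF actR_bimorphism rl(1)]] .
qed (use rl in \<open>simp_all add: pairing_left actL_assoc pairing_closed actR_assoc pairing_right[symmetric]
      actL_closed actR_closed\<close>)

lemma rank_one_balanced: "balanced Q1D rank_one"
  unfolding balanced_def
proof (intro conjI ballI)
  show "bimorphism R L Q1D rank_one"
    unfolding bimorphism_def
  proof (intro conjI ballI)
    fix r assume r: "r \<in> carrier R"
    show "sup_morphism L Q1D (rank_one r)"
    proof (rule Q1_sup_morphismI[OF L_lattice])
      show "sup_morphism L L (\<lambda>l. fst (rank_one r l) l')" if l': "l' \<in> carrier L" for l'
        using bimorphism_right[OF actL_bimorphism pairing_closed[OF l' r]] by (simp add: rank_one_fst l')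
      show "sup_morphism L R (\<lambda>l. snd (rank_one r l) r')" if r': "r' \<in> carrier R" for r'
        using sup_morphism_comp[OF bimorphism_left[OF pairing_bimorphism r'] bimorphism_right[OF actR_bimorphism r]]
        by (simp add: rank_one_snd r')
    qed (rule rank_one_closed[OF r])
  next
    fix l assume l: "l \<in> carrier L"
    show "sup_morphism R Q1D (\<lambda>r. rank_one r l)"
    proof (rule Q1_sup_morphismI[OF R_lattice])
      show "sup_morphism R L (\<lambda>r. fst (rank_one r l) l')" if l': "l' \<in> carrier L" for l'
        using sup_morphism_comp[OF bimorphism_right[OF pairing_bimorphism l'] bimorphism_left[OF actL_bimorphism l]]
        by (simp add: rank_one_fst l')
      show "sup_morphism R R (\<lambda>r. snd (rank_one r l) r')" if r': "r' \<in> carrier R" for r'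
        using bimorphism_left[OF actR_bimorphism pairing_closed[OF l r']] by (simp add: rank_one_snd r')
    qed (rule rank_one_closed[OF _ l])
  qed
  \<comment> \<open>The pairing absorbs the scalar: (l'(rt))l = (l'r)(tl) on L, and (rt)(lr') =
    r((tl)r') on R.\<close>
  fix r t l assume "r \<in> carrier R" "t \<in> carrier T" "l \<in> carrier L"
  then show "rank_one (actR D r t) l = rank_one r (actL D t l)"
    by (intro Q1_eqI) (simp_all add: rank_one_closed actR_closed actL_closed rank_one_fst rank_one_snd
        pairing_right[symmetric] pairing_left actL_assoc actR_assoc pairing_closed)
qed

section \<open>The coupling map and the product of \<open>Q0\<close>\<close>

lemma \<phi>_lift: "\<phi> = Q0_lift D Q1D rank_one"
  by (simp add: coupling_phi_def rank_one_def[abs_def])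

lemma \<phi>_sup_morphism: "sup_morphism Q0L Q1D \<phi>"
  unfolding \<phi>_lift by (rule Q0_lift_sup_morphism[OF Q1_lattice rank_one_balanced])

lemma \<phi>_pure: "\<lbrakk>r \<in> carrier R; l \<in> carrier L\<rbrakk> \<Longrightarrow> \<phi> (r \<otimes> l) = rank_one r l"
  unfolding \<phi>_lift by (rule Q0_lift_pure[OF Q1_lattice rank_one_balanced])

lemma \<phi>_closed: "c \<in> carrier Q0L \<Longrightarrow> \<phi> c \<in> carrier Q1D"
  using sup_morphism_closed[OF \<phi>_sup_morphism] .

text \<open>The inner lift of \<open>Q0_mult\<close> has on r' (x) l' the value r(lr') (x) l', which
  is how \<open>rank_one r l\<close> acts from the left. The outer lift then has the values of a
  morphism already known from \<open>actl_bimorphism\<close>.\<close>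

lemma Q0_mult_eq_actl:
  assumes c: "c \<in> carrier Q0L" and c': "c' \<in> carrier Q0L"
  shows "Q0_mult D c c' = Q0_actl D (\<phi> c) c'"
  unfolding Q0_mult_def
proof (rule Q0_lift_of_morphism[OF _ c])
  show "sup_morphism Q0L Q0L (\<lambda>c. Q0_actl D (\<phi> c) c')"
    using sup_morphism_comp[OF \<phi>_sup_morphism bimorphism_left[OF actl_bimorphism c']] .
  fix r l assume rl: "r \<in> carrier R" "l \<in> carrier L"
  show "Q0_lift D Q0L (\<lambda>r'. Q0_pure D (actR D r (pairing D l r'))) c' = Q0_actl D (\<phi> (r \<otimes> l)) c'"
    by (rule Q0_lift_of_morphism[OF actl_sup_morphism c'])
      (simp_all add: rl \<phi>_pure rank_one_closed actl_pure rank_one_snd)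
qed

text \<open>Reduced to pure tensors first in c and then in c', the claim reads r(lr') (x) l' = r (x)
  (lr')l', which is balance with the scalar lr'.\<close>

lemma Q0_mult_eq_actr:
  assumes c: "c \<in> carrier Q0L" and c': "c' \<in> carrier Q0L"
  shows "Q0_mult D c c' = Q0_actr D c (\<phi> c')"
  unfolding Q0_mult_eq_actl[OF c c']
proof (rule Q0_morphism_eqI[OF _ _ _ c])
  show "sup_morphism Q0L Q0L (\<lambda>c. Q0_actl D (\<phi> c) c')"
    using sup_morphism_comp[OF \<phi>_sup_morphism bimorphism_left[OF actl_bimorphism c']] .
  show "sup_morphism Q0L Q0L (\<lambda>c. Q0_actr D c (\<phi> c'))"
    using actr_sup_morphism[OF \<phi>_closed[OF c']] .
  fix r l assume rl: "r \<in> carrier R" "l \<in> carrier L"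
  show "Q0_actl D (\<phi> (r \<otimes> l)) c' = Q0_actr D (r \<otimes> l) (\<phi> c')"
  proof (rule Q0_morphism_eqI[OF _ _ _ c'])
    show "sup_morphism Q0L Q0L (Q0_actl D (\<phi> (r \<otimes> l)))"
      by (intro actl_sup_morphism \<phi>_closed pure_closed rl)
    show "sup_morphism Q0L Q0L (\<lambda>c'. Q0_actr D (r \<otimes> l) (\<phi> c'))"
      using sup_morphism_comp[OF \<phi>_sup_morphism bimorphism_right[OF actr_bimorphism pure_closed[OF rl]]] .
  qed (use rl in \<open>simp add: \<phi>_pure rank_one_closed actl_pure actr_pure rank_one_fst rank_one_snd
        pure_balanced pairing_closed\<close>)
qed

lemma actl_mult:
  assumes q: "q \<in> carrier Q1D" "q' \<in> carrier Q1D" and c: "c \<in> carrier Q0L"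
  shows "Q0_actl D (q \<cdot>\<^bsub>Q1D\<^esub> q') c = Q0_actl D q (Q0_actl D q' c)"
proof (rule Q0_morphism_eqI[OF _ _ _ c])
  show "sup_morphism Q0L Q0L (Q0_actl D (q \<cdot>\<^bsub>Q1D\<^esub> q'))"
    by (intro actl_sup_morphism Q1_mult_closed q)
  show "sup_morphism Q0L Q0L (\<lambda>c. Q0_actl D q (Q0_actl D q' c))"
    using sup_morphism_comp[OF actl_sup_morphism[OF q(2)] actl_sup_morphism[OF q(1)]] .
qed (use q in \<open>simp add: actl_pure Q1_mult_closed Q1_mult_snd Q1_snd_closed\<close>)

lemma actr_mult:
  assumes q: "q \<in> carrier Q1D" "q' \<in> carrier Q1D" and c: "c \<in> carrier Q0L"
  shows "Q0_actr D c (q \<cdot>\<^bsub>Q1D\<^esub> q') = Q0_actr D (Q0_actr D c q) q'"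
proof (rule Q0_morphism_eqI[OF _ _ _ c])
  show "sup_morphism Q0L Q0L (\<lambda>c. Q0_actr D c (q \<cdot>\<^bsub>Q1D\<^esub> q'))"
    by (intro actr_sup_morphism Q1_mult_closed q)
  show "sup_morphism Q0L Q0L (\<lambda>c. Q0_actr D (Q0_actr D c q) q')"
    using sup_morphism_comp[OF actr_sup_morphism[OF q(1)] actr_sup_morphism[OF q(2)]] .
qed (use q in \<open>simp add: actr_pure Q1_mult_closed Q1_mult_fst Q1_fst_closed\<close>)

lemma actl_actr:
  assumes q: "q \<in> carrier Q1D" "q' \<in> carrier Q1D" and c: "c \<in> carrier Q0L"
  shows "Q0_actr D (Q0_actl D q c) q' = Q0_actl D q (Q0_actr D c q')"
proof (rule Q0_morphism_eqI[OF _ _ _ c])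
  show "sup_morphism Q0L Q0L (\<lambda>c. Q0_actr D (Q0_actl D q c) q')"
    using sup_morphism_comp[OF actl_sup_morphism[OF q(1)] actr_sup_morphism[OF q(2)]] .
  show "sup_morphism Q0L Q0L (\<lambda>c. Q0_actl D q (Q0_actr D c q'))"
    using sup_morphism_comp[OF actr_sup_morphism[OF q(2)] actl_sup_morphism[OF q(1)]] .
qed (use q in \<open>simp add: actr_pure actl_pure Q1_fst_closed Q1_snd_closed\<close>)

text \<open>For q = (\<alpha>, \<beta>) and a pure tensor, the R-component is the T-linearity
  \<beta>(r)(lr') = \<beta>(r(lr')), while the L-component (l'\<beta>(r))l = (\<alpha>(l')r)l is
  adjointness. In \<open>\<phi>_actr\<close> the two components exchange these roles.\<close>

lemma \<phi>_actl:
  assumes q: "q \<in> carrier Q1D" and c: "c \<in> carrier Q0L"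
  shows "\<phi> (Q0_actl D q c) = q \<cdot>\<^bsub>Q1D\<^esub> \<phi> c"
proof (rule Q0_morphism_eqI[OF _ _ _ c])
  show "sup_morphism Q0L Q1D (\<lambda>c. \<phi> (Q0_actl D q c))"
    using sup_morphism_comp[OF actl_sup_morphism[OF q] \<phi>_sup_morphism] .
  show "sup_morphism Q0L Q1D (\<lambda>c. q \<cdot>\<^bsub>Q1D\<^esub> \<phi> c)"
    using sup_morphism_comp[OF \<phi>_sup_morphism bimorphism_right[OF Q1_mult_bimorphism q]] .
  show "\<phi> (Q0_actl D q (r \<otimes> l)) = q \<cdot>\<^bsub>Q1D\<^esub> \<phi> (r \<otimes> l)" if "r \<in> carrier R" "l \<in> carrier L" for r l
    using that q by (intro Q1_eqI) (simp_all add: actl_pure \<phi>_pure rank_one_closed Q1_mult_closed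
      Q1_mult_fst Q1_mult_snd Q1_fst_closed Q1_snd_closed rank_one_fst rank_one_snd Q1_adjoint
      Q1_snd_actR pairing_closed)
qed

lemma \<phi>_actr:
  assumes q: "q \<in> carrier Q1D" and c: "c \<in> carrier Q0L"
  shows "\<phi> (Q0_actr D c q) = \<phi> c \<cdot>\<^bsub>Q1D\<^esub> q"
proof (rule Q0_morphism_eqI[OF _ _ _ c])
  show "sup_morphism Q0L Q1D (\<lambda>c. \<phi> (Q0_actr D c q))"
    using sup_morphism_comp[OF actr_sup_morphism[OF q] \<phi>_sup_morphism] .
  show "sup_morphism Q0L Q1D (\<lambda>c. \<phi> c \<cdot>\<^bsub>Q1D\<^esub> q)"
    using sup_morphism_comp[OF \<phi>_sup_morphism bimorphism_left[OF Q1_mult_bimorphism q]] .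
  show "\<phi> (Q0_actr D (r \<otimes> l) q) = \<phi> (r \<otimes> l) \<cdot>\<^bsub>Q1D\<^esub> q" if "r \<in> carrier R" "l \<in> carrier L" for r l
    using that q by (intro Q1_eqI) (simp_all add: actr_pure \<phi>_pure rank_one_closed Q1_mult_closed
      Q1_mult_fst Q1_mult_snd Q1_fst_closed Q1_snd_closed rank_one_fst rank_one_snd Q1_adjoint
      Q1_fst_actL pairing_closed)
qed

lemma Q0_quantale: "quantale (Q0 D)"
proof (rule quantale.intro[OF Q0_complete], unfold_locales)
  have "bimorphism Q0L Q0L Q0L (\<lambda>c c'. Q0_actl D (\<phi> c) c')"
    by (rule bimorphism_comp_left[OF \<phi>_sup_morphism actl_bimorphism])
  then show "bimorphism (Q0 D) (Q0 D) (Q0 D) (qmult (Q0 D))"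
    by (simp add: Q0_mult_eq_actl bimorphism_cong[OF Q0_lattice_complete Q0_lattice_complete,
          of "Q0_mult D" "\<lambda>c c'. Q0_actl D (\<phi> c) c'"])
  \<comment> \<open>Since \<phi>(\<phi>(a)b) = \<phi>(a)\<phi>(b), both sides are
    \<phi>(a)(\<phi>(b)c).\<close>
  show "a \<cdot>\<^bsub>Q0 D\<^esub> b \<cdot>\<^bsub>Q0 D\<^esub> c = a \<cdot>\<^bsub>Q0 D\<^esub> (b \<cdot>\<^bsub>Q0 D\<^esub> c)"
    if "a \<in> carrier (Q0 D)" "b \<in> carrier (Q0 D)" "c \<in> carrier (Q0 D)" for a b c
    using that by (simp add: Q0_mult_eq_actl actl_closed \<phi>_closed \<phi>_actl actl_mult)
qed

lemma Q0_couple: "couple (Q0 D) Q1D (Q0_actl D) (Q0_actr D) \<phi>"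
proof (rule couple.intro)
  show "quantale (Q0 D)" "quantale Q1D" by (rule Q0_quantale Q1_quantale)+
  show "bimodule Q1D Q1D (Q0 D) (Q0_actl D) (Q0_actr D)"
    by (simp add: bimodule_def left_module_def right_module_def Q1_quantale Q0_complete
        actl_bimorphism actr_bimorphism actl_mult actr_mult actl_actr)
  show "quantale_morphism (Q0 D) Q1D \<phi>"
    by (simp add: quantale_morphism_def \<phi>_sup_morphism Q0_mult_eq_actl \<phi>_actl \<phi>_closed)
  show "left_module_morphism Q1D (Q0 D) (Q0_actl D) Q1D (qmult Q1D) \<phi>"
    by (simp add: left_module_morphism_def \<phi>_sup_morphism \<phi>_actl)
  show "right_module_morphism Q1D (Q0 D) (Q0_actr D) Q1D (qmult Q1D) \<phi>"
    by (simp add: right_module_morphism_def \<phi>_sup_morphism \<phi>_actr)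
  show "c \<cdot>\<^bsub>Q0 D\<^esub> c' = Q0_actl D (\<phi> c) c'" "c \<cdot>\<^bsub>Q0 D\<^esub> c' = Q0_actr D c (\<phi> c')"
    if "c \<in> carrier (Q0 D)" "c' \<in> carrier (Q0 D)" for c c'
    using that Q0_mult_eq_actl Q0_mult_eq_actr by simp_all
qed

end


section \<open>The involutions\<close>

context involutive_triad
begin

lemma starL_closed: "l \<in> carrier L \<Longrightarrow> starL D l \<in> carrier R"
  using sup_morphism_closed[OF starL_sup] .

lemma starR_closed: "r \<in> carrier R \<Longrightarrow> starR D r \<in> carrier L"
  using sup_morphism_closed[OF starR_sup] .

lemma starT_closed: "t \<in> carrier T \<Longrightarrow> starT D t \<in> carrier T"
  using sup_morphism_closed[OF involutive_quantale.star_sup[OF involutive_T]] .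

lemma starT_starT: "t \<in> carrier T \<Longrightarrow> starT D (starT D t) = t"
  using involutive_quantale.star_star[OF involutive_T] .

section \<open>The involution of \<open>Q1\<close>\<close>

lemma
  shows Q1_star_fst: "l \<in> carrier L \<Longrightarrow> fst (Q1_star D q) l = starR D (snd q (starL D l))"
    and Q1_star_snd: "r \<in> carrier R \<Longrightarrow> snd (Q1_star D q) r = starL D (fst q (starR D r))"
  by (simp_all add: Q1_star_def split: prod.splits)

lemma Q1_star_closed:
  assumes q: "q \<in> carrier Q1D"
  shows "Q1_star D q \<in> carrier Q1D"
proof -
  have "Q1_star D q = (restrict (\<lambda>l. starR D (snd q (starL D l))) (carrier L),
      restrict (\<lambda>r. starL D (fst q (starR D r))) (carrier R))"
    by (simp add: Q1_star_def split: prod.splits)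
  also have "\<dots> \<in> carrier Q1D"
  proof (rule Q1_restrict_carrierI)
    show "sup_morphism L L (\<lambda>l. starR D (snd q (starL D l)))"
      using sup_morphism_comp[OF sup_morphism_comp[OF starL_sup Q1_snd_sup_morphism[OF q]] starR_sup] .
    show "sup_morphism R R (\<lambda>r. starL D (fst q (starR D r)))"
      using sup_morphism_comp[OF sup_morphism_comp[OF starR_sup Q1_fst_sup_morphism[OF q]] starL_sup] .
    show "pairing D (starR D (snd q (starL D l))) r = pairing D l (starL D (fst q (starR D r)))"
      if l: "l \<in> carrier L" and r: "r \<in> carrier R" for l r
    proof -
      \<comment> \<open>The involution of T carries the adjointness of q at the pair r*, l* to that
        of its star at l, r. Writing r as a double star brings the pairing into the form of
        \<open>star_pairing\<close>.\<close>
      have "pairing D (starR D (snd q (starL D l))) (starL D (starR D r)) =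
          starT D (pairing D (starR D r) (snd q (starL D l)))"
        using l r q by (simp add: star_pairing starR_closed starL_closed Q1_snd_closed)
      also have "\<dots> = starT D (pairing D (fst q (starR D r)) (starL D l))"
        using l r q by (simp add: Q1_adjoint starR_closed starL_closed)
      also have "\<dots> = pairing D (starR D (starL D l)) (starL D (fst q (starR D r)))"
        using l r q by (simp add: star_pairing starR_closed starL_closed Q1_fst_closed)
      finally show ?thesis using l r by (simp add: starR_starL starL_starR)
    qed
  qed (use q in \<open>simp_all add: star_actL star_actR Q1_fst_actL Q1_snd_actR Q1_fst_closed Q1_snd_closed
        starL_closed starR_closed starT_closed starT_starT\<close>)
  finally show ?thesis .
qed

lemma Q1_involutive: "involutive_quantale Q1D (Q1_star D)"
proof (rule involutive_quantale.intro[OF Q1_quantale], unfold_locales)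
  show "sup_morphism Q1D Q1D (Q1_star D)"
  proof (rule Q1_sup_morphismI[OF Q1_lattice Q1_star_closed])
    show "sup_morphism Q1D L (\<lambda>q. fst (Q1_star D q) l)" if "l \<in> carrier L" for l
      using sup_morphism_comp[OF Q1_eval_snd[OF starL_closed[OF that]] starR_sup]
      by (simp add: Q1_star_fst that)
    show "sup_morphism Q1D R (\<lambda>q. snd (Q1_star D q) r)" if "r \<in> carrier R" for r
      using sup_morphism_comp[OF Q1_eval_fst[OF starR_closed[OF that]] starL_sup]
      by (simp add: Q1_star_snd that)
  qed
  show "Q1_star D (Q1_star D q) = q" if "q \<in> carrier Q1D" for q
    using that by (intro Q1_eqI) (simp_all add: Q1_star_closed Q1_star_fst Q1_star_snd starL_closed
      starR_closed starR_starL starL_starR Q1_fst_closed Q1_snd_closed)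
  show "Q1_star D (q \<cdot>\<^bsub>Q1D\<^esub> q') = Q1_star D q' \<cdot>\<^bsub>Q1D\<^esub> Q1_star D q"
    if "q \<in> carrier Q1D" "q' \<in> carrier Q1D" for q q'
    using that by (intro Q1_eqI) (simp_all add: Q1_star_closed Q1_mult_closed Q1_star_fst Q1_star_snd
      Q1_mult_fst Q1_mult_snd starL_closed starR_closed starR_starL starL_starR Q1_fst_closed Q1_snd_closed)
qed

section \<open>The involution of the tensor product over T\<close>

lemma star_pure_balanced: "balanced Q0L (\<lambda>r l. starL D l \<otimes> starR D r)"
  unfolding balanced_def
proof (intro conjI ballI)
  \<comment> \<open>Stated with L first: the star exchanges the factors, so it is l* that lands in R
    and r* in L.\<close>
  have "bimorphism L R Q0L (\<lambda>l r. starL D l \<otimes> starR D r)"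
    by (rule bimorphism_comp_left[OF starL_sup bimorphism_comp_right[OF starR_sup pure_bimorphism]])
  then show "bimorphism R L Q0L (\<lambda>r l. starL D l \<otimes> starR D r)"
    by (subst bimorphism_flip)
qed (simp add: star_actL star_actR pure_balanced starL_closed starR_closed starT_closed)

lemma Q0_star_sup_morphism: "sup_morphism Q0L Q0L (Q0_star D)"
  unfolding Q0_star_def by (rule Q0_lift_sup_morphism[OF Q0_lattice_complete star_pure_balanced])

lemma Q0_star_pure:
  "\<lbrakk>r \<in> carrier R; l \<in> carrier L\<rbrakk> \<Longrightarrow> Q0_star D (r \<otimes> l) = starL D l \<otimes> starR D r"
  unfolding Q0_star_def by (rule Q0_lift_pure[OF Q0_lattice_complete star_pure_balanced])

lemma Q0_star_closed: "c \<in> carrier Q0L \<Longrightarrow> Q0_star D c \<in> carrier Q0L"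
  using sup_morphism_closed[OF Q0_star_sup_morphism] .

lemma Q0_star_star:
  assumes c: "c \<in> carrier Q0L"
  shows "Q0_star D (Q0_star D c) = c"
proof (rule Q0_morphism_eqI[OF _ _ _ c])
  show "sup_morphism Q0L Q0L (\<lambda>c. Q0_star D (Q0_star D c))"
    by (rule sup_morphism_comp[OF Q0_star_sup_morphism Q0_star_sup_morphism])
  show "sup_morphism Q0L Q0L (\<lambda>c. c)" by (rule sup_morphism_id)
qed (simp add: Q0_star_pure starL_closed starR_closed starR_starL starL_starR)

lemma Q0_star_actl:
  assumes q: "q \<in> carrier Q1D" and c: "c \<in> carrier Q0L"
  shows "Q0_star D (Q0_actl D q c) = Q0_actr D (Q0_star D c) (Q1_star D q)"
proof (rule Q0_morphism_eqI[OF _ _ _ c])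
  show "sup_morphism Q0L Q0L (\<lambda>c. Q0_star D (Q0_actl D q c))"
    using sup_morphism_comp[OF actl_sup_morphism[OF q] Q0_star_sup_morphism] .
  show "sup_morphism Q0L Q0L (\<lambda>c. Q0_actr D (Q0_star D c) (Q1_star D q))"
    using sup_morphism_comp[OF Q0_star_sup_morphism actr_sup_morphism[OF Q1_star_closed[OF q]]] .
qed (use q in \<open>simp add: Q0_star_pure actl_pure actr_pure Q1_star_closed Q1_star_fst starL_closed
      starR_closed starL_starR Q1_snd_closed\<close>)

lemma \<phi>_star:
  assumes c: "c \<in> carrier Q0L"
  shows "\<phi> (Q0_star D c) = Q1_star D (\<phi> c)"
proof (rule Q0_morphism_eqI[OF _ _ _ c])
  show "sup_morphism Q0L Q1D (\<lambda>c. \<phi> (Q0_star D c))"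
    by (rule sup_morphism_comp[OF Q0_star_sup_morphism \<phi>_sup_morphism])
  show "sup_morphism Q0L Q1D (\<lambda>c. Q1_star D (\<phi> c))"
    using sup_morphism_comp[OF \<phi>_sup_morphism involutive_quantale.star_sup[OF Q1_involutive]] .
  show "\<phi> (Q0_star D (r \<otimes> l)) = Q1_star D (\<phi> (r \<otimes> l))" if rl: "r \<in> carrier R" "l \<in> carrier L" for r l
  proof (rule Q1_eqI)
    show "\<phi> (Q0_star D (r \<otimes> l)) \<in> carrier Q1D" "Q1_star D (\<phi> (r \<otimes> l)) \<in> carrier Q1D"
      using rl by (simp_all add: \<phi>_closed Q0_star_closed Q1_star_closed pure_closed)
    show "fst (\<phi> (Q0_star D (r \<otimes> l))) l' = fst (Q1_star D (\<phi> (r \<otimes> l))) l'" if "l' \<in> carrier L" for l'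
      using rl that by (simp add: Q0_star_pure \<phi>_pure starL_closed starR_closed Q1_star_fst
          rank_one_fst rank_one_snd star_actR pairing_closed star_pairing starR_starL)
    show "snd (\<phi> (Q0_star D (r \<otimes> l))) r' = snd (Q1_star D (\<phi> (r \<otimes> l))) r'" if "r' \<in> carrier R" for r'
      using rl that by (simp add: Q0_star_pure \<phi>_pure starL_closed starR_closed Q1_star_snd
          rank_one_fst rank_one_snd star_actL pairing_closed star_pairing starL_starR)
  qed
qed

lemma Q0_involutive: "involutive_quantale (Q0 D) (Q0_star D)"
proof (rule involutive_quantale.intro[OF Q0_quantale], unfold_locales)
  show "Q0_star D (c \<cdot>\<^bsub>Q0 D\<^esub> c') = Q0_star D c' \<cdot>\<^bsub>Q0 D\<^esub> Q0_star D c"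
    if "c \<in> carrier (Q0 D)" "c' \<in> carrier (Q0 D)" for c c'
    using that Q0_mult_eq_actr[of "Q0_star D c'" "Q0_star D c"]
    by (simp add: Q0_mult_eq_actl[of c c'] Q0_star_actl \<phi>_closed \<phi>_star Q0_star_closed)
qed (simp_all add: Q0_star_sup_morphism Q0_star_star)

lemma Q0_involutive_couple:
  "involutive_couple (Q0 D) Q1D (Q0_actl D) (Q0_actr D) \<phi> (Q0_star D) (Q1_star D)"
proof (rule involutive_couple.intro[OF Q0_couple], rule involutive_couple_axioms.intro)
  show "involutive_morphism (Q0 D) (Q0_star D) Q1D (Q1_star D) \<phi>"
    using couple.coupling_quantale_morphism[OF Q0_couple] by (simp add: involutive_morphism_def \<phi>_star)
qed (simp_all add: Q0_involutive Q1_involutive Q0_star_actl)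

end


section \<open>Solutions and factorizations\<close>

context triad
begin

lemma Q1_bimorphism_R: "bimorphism Q1D R R snd"
  by (simp add: bimorphism_def Q1_snd_sup_morphism Q1_eval_snd)

lemma Q1_bimorphism_L: "bimorphism L Q1D L (\<lambda>l q. fst q l)"
  by (simp add: bimorphism_def Q1_fst_sup_morphism Q1_eval_fst)

end

context involutive_triad
begin

text \<open>The axioms of a solution match those of a factorization one group at a time. The
  bimodule laws come from multiplicativity of \<open>\<phi>1\<close> and T-linearity in
  \<open>Q1\<close>; (lq)r = l(qr) is adjointness in \<open>Q1\<close>; (qr)l = q(rl) and (rl)q =
  r(lq) are the linearity of \<open>\<phi>0\<close>; (rt)l = r(tl) is balance; the two laws for
  (rl)r' and (lr)l' come from \<open>\<phi>1\<close> after \<open>\<phi>0\<close> being the coupling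
  map.\<close>

lemma solution_of_factorization_in:
  assumes "(\<phi>0, \<phi>1) \<in> involutive_factorizations D K star"
  shows "solution_of_factorization D K (\<phi>0, \<phi>1) \<in> involutive_solutions D K star"
proof -
  define qR where "qR = (\<lambda>k\<in>carrier K. \<lambda>r\<in>carrier R. snd (\<phi>1 k) r)"
  define Lq where "Lq = (\<lambda>l\<in>carrier L. \<lambda>k\<in>carrier K. fst (\<phi>1 k) l)"
  define RL where "RL = (\<lambda>r\<in>carrier R. \<lambda>l\<in>carrier L. \<phi>0 (r \<otimes> l))"
  have qR: "qR k r = snd (\<phi>1 k) r" if "k \<in> carrier K" "r \<in> carrier R" for k r
    using that by (simp add: qR_def)
  have Lq: "Lq l k = fst (\<phi>1 k) l" if "l \<in> carrier L" "k \<in> carrier K" for k l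
    using that by (simp add: Lq_def)
  have RL: "RL r l = \<phi>0 (r \<otimes> l)" if "r \<in> carrier R" "l \<in> carrier L" for r l
    using that by (simp add: RL_def)
  interpret F: involutive_couple_factorization "Q0 D" Q1D "Q0_actl D" "Q0_actr D" \<phi> "Q0_star D"
    "Q1_star D" K \<phi>0 \<phi>1 star
    using assms by (simp add: involutive_factorizations_def)
  have K: "complete_lattice K" using F.quantale_K by (rule quantale.axioms)
  have \<phi>0: "sup_morphism Q0L K \<phi>0"
    using F.morphism0 by (simp add: quantale_morphism_def)
  have \<phi>0_closed: "\<phi>0 c \<in> carrier K" if "c \<in> carrier Q0L" for c
    using sup_morphism_closed[OF \<phi>0 that] .
  have \<phi>1_mult: "\<phi>1 (k \<cdot>\<^bsub>K\<^esub> k') = \<phi>1 k \<cdot>\<^bsub>Q1D\<^esub> \<phi>1 k'" if "k \<in> carrier K" "k' \<in> carrier K" for k k'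
    using F.morphism1 that by (simp add: quantale_morphism_def)
  have \<phi>1: "sup_morphism K Q1D \<phi>1"
    using F.morphism1 by (simp add: quantale_morphism_def)
  have \<phi>1_closed: "\<phi>1 k \<in> carrier Q1D" if "k \<in> carrier K" for k
    using sup_morphism_closed[OF \<phi>1 that] .
  have factorizes: "\<phi>1 (\<phi>0 c) = \<phi> c" if "c \<in> carrier Q0L" for c
    using F.factorizes that by simp
  have \<phi>0_actl: "\<phi>0 (Q0_actl D (\<phi>1 k) c) = k \<cdot>\<^bsub>K\<^esub> \<phi>0 c"
    and \<phi>0_actr: "\<phi>0 (Q0_actr D c (\<phi>1 k)) = \<phi>0 c \<cdot>\<^bsub>K\<^esub> k" if "k \<in> carrier K" "c \<in> carrier Q0L" for k c
    using couple.coupling_left[OF F.coupling0] couple.coupling_right[OF F.coupling0] that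
    by (simp_all add: left_module_morphism_def right_module_morphism_def)
  have \<phi>0_star: "\<phi>0 (Q0_star D c) = star (\<phi>0 c)" if "c \<in> carrier Q0L" for c
    using F.involutive0 that by (simp add: involutive_morphism_def)
  have \<phi>1_star: "\<phi>1 (star k) = Q1_star D (\<phi>1 k)" if "k \<in> carrier K" for k
    using F.involutive1 that by (simp add: involutive_morphism_def)
  have star_closed: "star k \<in> carrier K" if "k \<in> carrier K" for k
    using sup_morphism_closed[OF involutive_quantale.star_sup[OF F.involutive_K] that] .
  interpret K: quantale K by (rule F.quantale_K)
  have K_mult_closed: "k \<cdot>\<^bsub>K\<^esub> k' \<in> carrier K" if "k \<in> carrier K" "k' \<in> carrier K" for k k'
    using bimorphism_closed[OF K.qmult_bimorphism that] .
  \<comment> \<open>The restricted structure maps agree with these formulas on the carriers only, so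
    bimorphism laws are shown for the formulas and then transferred.\<close>
  have "bimorphism K R R (\<lambda>k r. snd (\<phi>1 k) r)"
    by (rule bimorphism_comp_left[OF \<phi>1 Q1_bimorphism_R])
  then have qR_bi: "bimorphism K R R qR"
    by (subst bimorphism_cong[OF K R_lattice]) (simp_all add: qR)
  have "bimorphism L K L (\<lambda>l k. fst (\<phi>1 k) l)"
    by (rule bimorphism_comp_right[OF \<phi>1 Q1_bimorphism_L])
  then have Lq_bi: "bimorphism L K L Lq"
    by (subst bimorphism_cong[OF L_lattice K]) (simp_all add: Lq)
  have "bimorphism R L K (\<lambda>r l. \<phi>0 (r \<otimes> l))"
    by (rule bimorphism_comp[OF pure_bimorphism \<phi>0])
  then have RL_bi: "bimorphism R L K RL"
    by (subst bimorphism_cong[OF R_lattice L_lattice]) (simp_all add: RL)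
  have "involutive_solution D K qR Lq RL star"
  proof (intro involutive_solution.intro solution.intro solution_axioms.intro involutive_solution_axioms.intro)
    show "triad D" "involutive_triad D" by (rule triad_axioms involutive_triad_axioms)+
    show "quantale K" "involutive_quantale K star" by (rule F.quantale_K F.involutive_K)+
    show "bimodule K T R qR (actR D)"
      unfolding bimodule_def left_module_def
      using module_R by (simp add: F.quantale_K R_lattice qR_bi qR \<phi>1_mult K_mult_closed
          Q1_mult_snd Q1_snd_closed \<phi>1_closed Q1_snd_actR actR_closed)
    show "bimodule T K L (actL D) Lq"
      unfolding bimodule_def right_module_def
      using module_L by (simp add: F.quantale_K L_lattice Lq_bi Lq \<phi>1_mult K_mult_closed
          Q1_mult_fst Q1_fst_closed \<phi>1_closed Q1_fst_actL actL_closed)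
    show "bimorphism R L K RL" by (rule RL_bi)
    show "RL (qR k r) l = k \<cdot>\<^bsub>K\<^esub> RL r l" if "k \<in> carrier K" "r \<in> carrier R" "l \<in> carrier L" for k r l
      using that \<phi>0_actl[of k "r \<otimes> l"]
      by (simp add: qR RL Q1_snd_closed \<phi>1_closed pure_closed actl_pure)
    show "RL r l \<cdot>\<^bsub>K\<^esub> k = RL r (Lq l k)" if "k \<in> carrier K" "r \<in> carrier R" "l \<in> carrier L" for k r l
      using that \<phi>0_actr[of k "r \<otimes> l"]
      by (simp add: Lq RL Q1_fst_closed \<phi>1_closed pure_closed actr_pure)
    show "RL (actR D r t) l = RL r (actL D t l)"
      if "t \<in> carrier T" "r \<in> carrier R" "l \<in> carrier L" for t r l
      using that by (simp add: RL actR_closed actL_closed pure_balanced)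
    show "pairing D (Lq l k) r = pairing D l (qR k r)"
      if "k \<in> carrier K" "r \<in> carrier R" "l \<in> carrier L" for k r l
      using that by (simp add: Lq qR Q1_adjoint \<phi>1_closed)
    \<comment> \<open>The factorization enters here: rl acts through
      \<open>\<phi>1 (\<phi>0 (r \<otimes> l))\<close>, which is
      \<open>rank_one r l\<close>.\<close>
    show "qR (RL r l) r' = actR D r (pairing D l r')"
      if "r \<in> carrier R" "l \<in> carrier L" "r' \<in> carrier R" for r l r'
      using that by (simp add: qR RL \<phi>0_closed pure_closed factorizes \<phi>_pure rank_one_snd)
    show "actL D (pairing D l r) l' = Lq l (RL r l')"
      if "l \<in> carrier L" "r \<in> carrier R" "l' \<in> carrier L" for l r l'
      using that by (simp add: Lq RL \<phi>0_closed pure_closed factorizes \<phi>_pure rank_one_fst)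
    show "starR D (qR k r) = Lq (starR D r) (star k)" if "k \<in> carrier K" "r \<in> carrier R" for k r
      using that by (simp add: qR Lq starR_closed star_closed \<phi>1_star Q1_star_fst starL_starR)
    show "starL D (Lq l k) = qR (star k) (starL D l)" if "k \<in> carrier K" "l \<in> carrier L" for k l
      using that by (simp add: qR Lq starL_closed star_closed \<phi>1_star Q1_star_snd starR_starL)
    show "star (RL r l) = RL (starL D l) (starR D r)" if "r \<in> carrier R" "l \<in> carrier L" for r l
      using that \<phi>0_star[of "r \<otimes> l"]
      by (simp add: RL starL_closed starR_closed Q0_star_pure pure_closed)
  qed
  moreover have "qR \<in> carrier K \<rightarrow>\<^sub>E carrier R \<rightarrow>\<^sub>E carrier R"
    using bimorphism_closed[OF qR_bi] by (auto simp: qR_def)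
  moreover have "Lq \<in> carrier L \<rightarrow>\<^sub>E carrier K \<rightarrow>\<^sub>E carrier L"
    using bimorphism_closed[OF Lq_bi] by (auto simp: Lq_def)
  moreover have "RL \<in> carrier R \<rightarrow>\<^sub>E carrier L \<rightarrow>\<^sub>E carrier K"
    using bimorphism_closed[OF RL_bi] by (auto simp: RL_def)
  moreover have "solution_of_factorization D K (\<phi>0, \<phi>1) = (qR, Lq, RL)"
    by (simp add: solution_of_factorization_def qR_def Lq_def RL_def)
  ultimately show ?thesis by (simp add: involutive_solutions_def)
qed

text \<open>The solution records the value of \<open>\<phi>0\<close> at every pure tensor and every
  evaluation of \<open>\<phi>1\<close>. These determine both maps on the carriers, and
  extensionality determines them elsewhere.\<close>

lemma solution_of_factorization_inj:
  "inj_on (solution_of_factorization D K) (involutive_factorizations D K star)"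
proof (rule inj_onI, clarify)
  fix \<phi>0 \<phi>1 \<psi>0 \<psi>1
  assume \<phi>: "(\<phi>0, \<phi>1) \<in> involutive_factorizations D K star"
    and \<psi>: "(\<psi>0, \<psi>1) \<in> involutive_factorizations D K star"
    and eq: "solution_of_factorization D K (\<phi>0, \<phi>1) = solution_of_factorization D K (\<psi>0, \<psi>1)"
  have fact: "\<chi>0 \<in> extensional (carrier Q0L) \<and> sup_morphism Q0L K \<chi>0 \<and>
      \<chi>1 \<in> carrier K \<rightarrow>\<^sub>E carrier Q1D" if "(\<chi>0, \<chi>1) \<in> involutive_factorizations D K star" for \<chi>0 \<chi>1
  proof -
    from that have "involutive_couple_factorization (Q0 D) Q1D (Q0_actl D) (Q0_actr D) \<phi> (Q0_star D)
        (Q1_star D) K \<chi>0 \<chi>1 star"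
      by (simp add: involutive_factorizations_def)
    then have "quantale_morphism (Q0 D) K \<chi>0"
      by (intro couple_factorization.morphism0 involutive_couple_factorization.axioms)
    then show ?thesis
      using that by (auto simp: involutive_factorizations_def quantale_morphism_def PiE_def)
  qed
  \<comment> \<open>One component of the equal triples is evaluated at carrier elements, where the
    restrictions disappear.\<close>
  have snd_eq: "snd (\<phi>1 k) r = snd (\<psi>1 k) r" if "k \<in> carrier K" "r \<in> carrier R" for k r
    using fun_cong[OF fun_cong[OF arg_cong[OF eq, of fst], of k], of r] that
    by (simp add: solution_of_factorization_def)
  have fst_eq: "fst (\<phi>1 k) l = fst (\<psi>1 k) l" if "k \<in> carrier K" "l \<in> carrier L" for k l
    using fun_cong[OF fun_cong[OF arg_cong[OF eq, of "\<lambda>x. fst (snd x)"], of l], of k] that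
    by (simp add: solution_of_factorization_def)
  have pure_eq: "\<phi>0 (r \<otimes> l) = \<psi>0 (r \<otimes> l)" if "r \<in> carrier R" "l \<in> carrier L" for r l
    using fun_cong[OF fun_cong[OF arg_cong[OF eq, of "\<lambda>x. snd (snd x)"], of r], of l] that
    by (simp add: solution_of_factorization_def)
  show "\<phi>0 = \<psi>0 \<and> \<phi>1 = \<psi>1"
  proof
    show "\<phi>0 = \<psi>0"
      using fact[OF \<phi>] fact[OF \<psi>] pure_eq
      by (intro extensionalityI[of _ "carrier Q0L"]) (auto intro: Q0_morphism_eqI[of K])
    show "\<phi>1 = \<psi>1"
    proof (rule PiE_ext)
      show \<phi>1: "\<phi>1 \<in> carrier K \<rightarrow>\<^sub>E carrier Q1D" and \<psi>1: "\<psi>1 \<in> carrier K \<rightarrow>\<^sub>E carrier Q1D"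
        using fact[OF \<phi>] fact[OF \<psi>] by simp_all
      show "\<phi>1 k = \<psi>1 k" if "k \<in> carrier K" for k
        using that by (intro Q1_eqI PiE_mem[OF \<phi>1] PiE_mem[OF \<psi>1] fst_eq snd_eq)
    qed
  qed
qed

text \<open>The actions of K on L and R are packed into pairs, and (lq)r = l(qr) is what places
  these pairs in \<open>Q1\<close>. The law (rt)l = r(tl) makes \<open>RL\<close> balanced, so that
  it lifts to \<open>\<phi>0\<close>.\<close>

lemma solution_of_factorization_surj:
  assumes "(qR, Lq, RL) \<in> involutive_solutions D K star"
  shows "(qR, Lq, RL) \<in> solution_of_factorization D K ` involutive_factorizations D K star"
proof -
  from assms have qR_ext: "qR \<in> carrier K \<rightarrow>\<^sub>E carrier R \<rightarrow>\<^sub>E carrier R"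
    and Lq_ext: "Lq \<in> carrier L \<rightarrow>\<^sub>E carrier K \<rightarrow>\<^sub>E carrier L"
    and RL_ext: "RL \<in> carrier R \<rightarrow>\<^sub>E carrier L \<rightarrow>\<^sub>E carrier K"
    by (simp_all add: involutive_solutions_def)
  interpret S: involutive_solution D K qR Lq RL star
    using assms by (simp add: involutive_solutions_def)
  interpret K: quantale K by (rule S.quantale_Q)
  have K: "complete_lattice K" by (rule K.complete_lattice_axioms)
  have qR_bi: "bimorphism K R R qR"
    and qR_mult: "\<lbrakk>k \<in> carrier K; k' \<in> carrier K; r \<in> carrier R\<rbrakk> \<Longrightarrow> qR (k \<cdot>\<^bsub>K\<^esub> k') r = qR k (qR k' r)"
    and qR_actR: "\<lbrakk>k \<in> carrier K; t \<in> carrier T; r \<in> carrier R\<rbrakk> \<Longrightarrow> qR k (actR D r t) = actR D (qR k r) t"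
    for k k' r t
    using S.bimodule_R by (simp_all add: bimodule_def left_module_def)
  have Lq_bi: "bimorphism L K L Lq"
    and Lq_mult: "\<lbrakk>k \<in> carrier K; k' \<in> carrier K; l \<in> carrier L\<rbrakk> \<Longrightarrow> Lq l (k \<cdot>\<^bsub>K\<^esub> k') = Lq (Lq l k) k'"
    and Lq_actL: "\<lbrakk>k \<in> carrier K; t \<in> carrier T; l \<in> carrier L\<rbrakk> \<Longrightarrow> Lq (actL D t l) k = actL D t (Lq l k)"
    for k k' l t
    using S.bimodule_L by (simp_all add: bimodule_def right_module_def)
  note qR_closed = bimorphism_closed[OF qR_bi] and Lq_closed = bimorphism_closed[OF Lq_bi]
    and RL_closed = bimorphism_closed[OF S.RL_bimorphism]
  have K_mult_closed: "k \<cdot>\<^bsub>K\<^esub> k' \<in> carrier K" if "k \<in> carrier K" "k' \<in> carrier K" for k k'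
    using bimorphism_closed[OF K.qmult_bimorphism that] .
  have star_closed: "star k \<in> carrier K" if "k \<in> carrier K" for k
    using sup_morphism_closed[OF involutive_quantale.star_sup[OF S.involutive_Q] that] .
  define \<phi>1 where "\<phi>1 = (\<lambda>k\<in>carrier K. (\<lambda>l\<in>carrier L. Lq l k, \<lambda>r\<in>carrier R. qR k r))"
  define \<phi>0 where "\<phi>0 = Q0_lift D K RL"
  have \<phi>1_fst: "fst (\<phi>1 k) l = Lq l k" if "k \<in> carrier K" "l \<in> carrier L" for k l
    using that by (simp add: \<phi>1_def)
  have \<phi>1_snd: "snd (\<phi>1 k) r = qR k r" if "k \<in> carrier K" "r \<in> carrier R" for k r
    using that by (simp add: \<phi>1_def)
  have \<phi>1_closed: "\<phi>1 k \<in> carrier Q1D" if k: "k \<in> carrier K" for k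
    using k Q1_restrict_carrierI[OF bimorphism_left[OF Lq_bi k] Lq_actL[OF k]
        bimorphism_right[OF qR_bi k] qR_actR[OF k] S.sol_lqr[OF k]]
    by (simp add: \<phi>1_def)
  have \<phi>1_sup: "sup_morphism K Q1D \<phi>1"
  proof (rule Q1_sup_morphismI[OF K \<phi>1_closed])
    show "sup_morphism K L (\<lambda>k. fst (\<phi>1 k) l)" if "l \<in> carrier L" for l
      by (subst sup_morphism_cong[OF K, of _ "Lq l"]) (simp_all add: \<phi>1_fst that bimorphism_right[OF Lq_bi])
    show "sup_morphism K R (\<lambda>k. snd (\<phi>1 k) r)" if "r \<in> carrier R" for r
      by (subst sup_morphism_cong[OF K, of _ "\<lambda>k. qR k r"])
        (simp_all add: \<phi>1_snd that bimorphism_left[OF qR_bi])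
  qed
  have \<phi>1_mult: "\<phi>1 (k \<cdot>\<^bsub>K\<^esub> k') = \<phi>1 k \<cdot>\<^bsub>Q1D\<^esub> \<phi>1 k'" if "k \<in> carrier K" "k' \<in> carrier K" for k k'
    using that by (intro Q1_eqI) (simp_all add: \<phi>1_closed Q1_mult_closed K_mult_closed \<phi>1_fst \<phi>1_snd
      Q1_mult_fst Q1_mult_snd Lq_mult qR_mult Lq_closed qR_closed)
  have \<phi>1_star: "\<phi>1 (star k) = Q1_star D (\<phi>1 k)" if "k \<in> carrier K" for k
    using that by (intro Q1_eqI) (simp_all add: \<phi>1_closed Q1_star_closed star_closed \<phi>1_fst \<phi>1_snd
      Q1_star_fst Q1_star_snd starL_closed starR_closed S.star_qR S.star_Lq starR_starL starL_starR)
  have RL_balanced: "balanced K RL"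
    by (simp add: balanced_def S.RL_bimorphism S.sol_rtl)
  have \<phi>0_sup: "sup_morphism Q0L K \<phi>0"
    unfolding \<phi>0_def by (rule Q0_lift_sup_morphism[OF K RL_balanced])
  have \<phi>0_pure: "\<phi>0 (r \<otimes> l) = RL r l" if "r \<in> carrier R" "l \<in> carrier L" for r l
    unfolding \<phi>0_def by (rule Q0_lift_pure[OF K RL_balanced that])
  have \<phi>0_closed: "\<phi>0 c \<in> carrier K" if "c \<in> carrier Q0L" for c
    using sup_morphism_closed[OF \<phi>0_sup that] .
  have \<phi>0_ext: "\<phi>0 \<in> carrier Q0L \<rightarrow>\<^sub>E carrier K"
    using Q0_lift_extensional[OF K RL_balanced] \<phi>0_closed by (auto simp: \<phi>0_def PiE_def)
  \<comment> \<open>On a pure tensor this is the pair of axioms saying that rl acts on L by l'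
    \<mapsto> (l'r)l and on R by r' \<mapsto> r(lr').\<close>
  have factorizes: "\<phi>1 (\<phi>0 c) = \<phi> c" if c: "c \<in> carrier Q0L" for c
  proof (rule Q0_morphism_eqI[OF sup_morphism_comp[OF \<phi>0_sup \<phi>1_sup] \<phi>_sup_morphism _ c])
    show "\<phi>1 (\<phi>0 (r \<otimes> l)) = \<phi> (r \<otimes> l)" if "r \<in> carrier R" "l \<in> carrier L" for r l
      using that by (intro Q1_eqI) (simp_all add: \<phi>0_pure \<phi>_pure \<phi>1_closed RL_closed rank_one_closed
        \<phi>1_fst \<phi>1_snd rank_one_fst rank_one_snd S.sol_rlr S.sol_lrl)
  qed
  have \<phi>0_actl: "\<phi>0 (Q0_actl D (\<phi>1 k) c) = k \<cdot>\<^bsub>K\<^esub> \<phi>0 c" if k: "k \<in> carrier K" and c: "c \<in> carrier Q0L" for k c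
  proof (rule Q0_morphism_eqI[OF _ _ _ c])
    show "sup_morphism Q0L K (\<lambda>c. \<phi>0 (Q0_actl D (\<phi>1 k) c))"
      using sup_morphism_comp[OF actl_sup_morphism[OF \<phi>1_closed[OF k]] \<phi>0_sup] .
    show "sup_morphism Q0L K (\<lambda>c. k \<cdot>\<^bsub>K\<^esub> \<phi>0 c)"
      using sup_morphism_comp[OF \<phi>0_sup bimorphism_right[OF K.qmult_bimorphism k]] .
  qed (simp add: k \<phi>1_closed actl_pure \<phi>1_snd \<phi>0_pure qR_closed S.sol_qrl)
  have \<phi>0_actr: "\<phi>0 (Q0_actr D c (\<phi>1 k)) = \<phi>0 c \<cdot>\<^bsub>K\<^esub> k" if k: "k \<in> carrier K" and c: "c \<in> carrier Q0L" for k c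
  proof (rule Q0_morphism_eqI[OF _ _ _ c])
    show "sup_morphism Q0L K (\<lambda>c. \<phi>0 (Q0_actr D c (\<phi>1 k)))"
      using sup_morphism_comp[OF actr_sup_morphism[OF \<phi>1_closed[OF k]] \<phi>0_sup] .
    show "sup_morphism Q0L K (\<lambda>c. \<phi>0 c \<cdot>\<^bsub>K\<^esub> k)"
      using sup_morphism_comp[OF \<phi>0_sup bimorphism_left[OF K.qmult_bimorphism k]] .
  qed (simp add: k \<phi>1_closed actr_pure \<phi>1_fst \<phi>0_pure Lq_closed S.sol_rlq)
  have \<phi>0_star: "\<phi>0 (Q0_star D c) = star (\<phi>0 c)" if c: "c \<in> carrier Q0L" for c
  proof (rule Q0_morphism_eqI[OF _ _ _ c])
    show "sup_morphism Q0L K (\<lambda>c. \<phi>0 (Q0_star D c))"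
      by (rule sup_morphism_comp[OF Q0_star_sup_morphism \<phi>0_sup])
    show "sup_morphism Q0L K (\<lambda>c. star (\<phi>0 c))"
      by (rule sup_morphism_comp[OF \<phi>0_sup involutive_quantale.star_sup[OF S.involutive_Q]])
  qed (simp add: Q0_star_pure \<phi>0_pure starL_closed starR_closed S.star_RL)
  \<comment> \<open>Multiplicativity follows from linearity: \<open>\<phi>0\<close> of cc' is
    \<open>\<phi>0\<close> of \<open>\<phi>1 (\<phi>0 c)\<close> acting on c', hence
    \<open>\<phi>0 c\<close> times \<open>\<phi>0 c'\<close>.\<close>
  have \<phi>0_morphism: "quantale_morphism (Q0 D) K \<phi>0"
    using \<phi>0_actl[OF \<phi>0_closed] factorizes
    by (simp add: quantale_morphism_def \<phi>0_sup Q0_mult_eq_actl)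
  have \<phi>1_morphism: "quantale_morphism K Q1D \<phi>1"
    by (simp add: quantale_morphism_def \<phi>1_sup \<phi>1_mult)
  have "couple (Q0 D) K (\<lambda>k. Q0_actl D (\<phi>1 k)) (\<lambda>c k. Q0_actr D c (\<phi>1 k)) \<phi>0"
  proof (rule couple.intro)
    show "bimodule K K (Q0 D) (\<lambda>k. Q0_actl D (\<phi>1 k)) (\<lambda>c k. Q0_actr D c (\<phi>1 k))"
      by (simp add: bimodule_def left_module_def right_module_def K.quantale_axioms Q0_complete
          bimorphism_comp_left[OF \<phi>1_sup actl_bimorphism] bimorphism_comp_right[OF \<phi>1_sup actr_bimorphism]
          \<phi>1_mult \<phi>1_closed actl_mult actr_mult actl_actr)
    show "left_module_morphism K (Q0 D) (\<lambda>k. Q0_actl D (\<phi>1 k)) K (qmult K) \<phi>0"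
      by (simp add: left_module_morphism_def \<phi>0_sup \<phi>0_actl)
    show "right_module_morphism K (Q0 D) (\<lambda>c k. Q0_actr D c (\<phi>1 k)) K (qmult K) \<phi>0"
      by (simp add: right_module_morphism_def \<phi>0_sup \<phi>0_actr)
    show "c \<cdot>\<^bsub>Q0 D\<^esub> c' = Q0_actl D (\<phi>1 (\<phi>0 c)) c'" "c \<cdot>\<^bsub>Q0 D\<^esub> c' = Q0_actr D c (\<phi>1 (\<phi>0 c'))"
      if "c \<in> carrier (Q0 D)" "c' \<in> carrier (Q0 D)" for c c'
      using that Q0_mult_eq_actl Q0_mult_eq_actr by (simp_all add: factorizes)
  qed (rule Q0_quantale K.quantale_axioms \<phi>0_morphism)+
  then have "couple_factorization (Q0 D) Q1D (Q0_actl D) (Q0_actr D) \<phi> K \<phi>0 \<phi>1"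
    by (intro couple_factorization.intro couple_factorization_axioms.intro Q0_couple K.quantale_axioms
        \<phi>0_morphism \<phi>1_morphism) (simp_all add: factorizes)
  then have "involutive_couple_factorization (Q0 D) Q1D (Q0_actl D) (Q0_actr D) \<phi> (Q0_star D)
      (Q1_star D) K \<phi>0 \<phi>1 star"
    by (intro involutive_couple_factorization.intro involutive_couple_factorization_axioms.intro
        Q0_involutive_couple S.involutive_Q)
      (simp_all add: involutive_morphism_def \<phi>0_morphism \<phi>1_morphism \<phi>0_star \<phi>1_star)
  moreover have "\<phi>1 \<in> carrier K \<rightarrow>\<^sub>E carrier Q1D"
    using \<phi>1_closed by (auto simp: \<phi>1_def)
  ultimately have "(\<phi>0, \<phi>1) \<in> involutive_factorizations D K star"
    using \<phi>0_ext by (simp add: involutive_factorizations_def)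
  moreover have "solution_of_factorization D K (\<phi>0, \<phi>1) = (qR, Lq, RL)"
  proof -
    \<comment> \<open>Extensionality in both arguments makes restriction the identity, so the
      original triple is recovered as an equality of HOL functions and not merely on the
      carriers.\<close>
    have curried: "(\<lambda>x\<in>A. \<lambda>y\<in>B. f x y) = f" if "f \<in> A \<rightarrow>\<^sub>E B \<rightarrow>\<^sub>E C" for A B C f
      using that by (intro extensionalityI[of _ A]) (auto simp: PiE_def Pi_iff extensional_restrict)
    have "(\<lambda>k\<in>carrier K. \<lambda>r\<in>carrier R. snd (\<phi>1 k) r) = (\<lambda>k\<in>carrier K. \<lambda>r\<in>carrier R. qR k r)"
      "(\<lambda>l\<in>carrier L. \<lambda>k\<in>carrier K. fst (\<phi>1 k) l) = (\<lambda>l\<in>carrier L. \<lambda>k\<in>carrier K. Lq l k)"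
      "(\<lambda>r\<in>carrier R. \<lambda>l\<in>carrier L. \<phi>0 (r \<otimes> l)) = (\<lambda>r\<in>carrier R. \<lambda>l\<in>carrier L. RL r l)"
      by (simp_all add: \<phi>1_fst \<phi>1_snd \<phi>0_pure cong: restrict_cong)
    then show ?thesis
      by (simp add: solution_of_factorization_def curried[OF qR_ext] curried[OF Lq_ext] curried[OF RL_ext])
  qed
  ultimately show ?thesis by (metis imageI)
qed

end

theorem theorem4p4:
  fixes D :: "('l, 't, 'r) inv_triad"
    and K :: "'k quantale"
    and star :: "'k \<Rightarrow> 'k"
  assumes "involutive_triad D"
  shows "involutive_couple (Q0 D) (Q1 D) (Q0_actl D) (Q0_actr D) (coupling_phi D)
           (Q0_star D) (Q1_star D) \<and>
         (involutive_quantale K star \<longrightarrow>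
            bij_betw (solution_of_factorization D K)
              (involutive_factorizations D K star) (involutive_solutions D K star))"
proof -
  interpret involutive_triad D by fact
  have "solution_of_factorization D K ` involutive_factorizations D K star = involutive_solutions D K star"
    using solution_of_factorization_in solution_of_factorization_surj by auto
  then show ?thesis
    using Q0_involutive_couple solution_of_factorization_inj[of K star] by (simp add: bij_betw_def)
qed

end
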